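(* There is no uniform bound on the topological degree of a truly skew pentagram map $T^{(n)}_{a,b,c,d}$ over $\mathbb{C}$: for every $B\in\mathbb{N}$ there exist $n\ge 4$ and $a,b,c,d\in\mathbb{Z}$, distinct modulo $n$, with $|b-a|\neq|d-c|$, such that $T^{(n)}_{a,b,c,d}:(\mathbb{P}^2)^n\dashrightarrow(\mathbb{P}^2)^n$ is dominant and $\deg_{\mathrm{top}}(T^{(n)}_{a,b,c,d})>B$.
   Context: For $n\ge 4$ and $a,b,c,d\in\mathbb{Z}$ distinct modulo $n$, the skew pentagram map on closed $n$-gons is the rational map $T^{(n)}_{a,b,c,d}:(\mathbb{P}^2)^n\dashrightarrow(\mathbb{P}^2)^n$, $(v_i)\mapsto(v_i')$, $v_i'=\overline{v_{i+a}v_{i+b}}\cap\overline{v_{i+c}v_{i+d}}$, indices modulo $n$, where $\overline{pq}$ is the line through distinct points $p,q$. It is truly skew if $|b-a|\ne|d-c|$. For a dominant rational map $f:X\dashrightarrow Y$ with $Y$ irreducible (here $\dim X=\dim Y$), there is a Zariski dense open $U\subset Y$ over which the fibers of $f$ (restricted to its domain of definition) have constant cardinality; this constant is the (generic) topological degree $\deg_{\mathrm{top}}f$. *)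

theory Defs
  imports "HOL-Analysis.Analysis"
begin

section \<open>The complex projective plane\<close>

text \<open>Points are the one-dimensional subspaces of the vector space of complex triples;
  \<open>vec.span\<close> is the span over the complex numbers.\<close>

typedef cp2 = "{vec.span {x} | x :: complex^3. x \<noteq> 0}"
  by (auto intro!: exI[of _ "axis 1 1"] simp: axis_eq_0_iff)

definition proj :: "complex^3 \<Rightarrow> cp2" where
  "proj x = Abs_cp2 (vec.span {x})"  \<comment> \<open>meaningful for nonzero \<open>x\<close> only\<close>

definition proj_line :: "cp2 \<Rightarrow> cp2 \<Rightarrow> cp2 set" where
  "proj_line p q = {r. Rep_cp2 r \<subseteq> vec.span (Rep_cp2 p \<union> Rep_cp2 q)}"


section \<open>Products of projective planes and their Zariski topology\<close>

text \<open>The product of copies of the plane indexed by a finite set \<open>I\<close>.\<close>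

abbreviation cp2_pow :: "'i set \<Rightarrow> ('i \<Rightarrow> cp2) set" where
  "cp2_pow I \<equiv> PiE I (\<lambda>_. UNIV)"

text \<open>Systems of homogeneous coordinates for \<open>v\<close>.\<close>

definition hom_coords :: "'i set \<Rightarrow> ('i \<Rightarrow> cp2) \<Rightarrow> ('i \<Rightarrow> complex^3) set" where
  "hom_coords I v = {x. \<forall>i\<in>I. x i \<noteq> 0 \<and> proj (x i) = v i}"

text \<open>Polynomials in the \<open>3 |I|\<close> homogeneous coordinates are identified with the functions
  they define, which loses nothing over an infinite field.\<close>

inductive polynomial_fun :: "'i set \<Rightarrow> (('i \<Rightarrow> complex^3) \<Rightarrow> complex) \<Rightarrow> bool"
  for I :: "'i set"
where
  const: "polynomial_fun I (\<lambda>x. c)"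
| coord: "i \<in> I \<Longrightarrow> polynomial_fun I (\<lambda>x. x i $ k)"
| add: "polynomial_fun I F \<Longrightarrow> polynomial_fun I G \<Longrightarrow> polynomial_fun I (\<lambda>x. F x + G x)"
| mult: "polynomial_fun I F \<Longrightarrow> polynomial_fun I G \<Longrightarrow> polynomial_fun I (\<lambda>x. F x * G x)"

definition multihomogeneous ::
  "'i set \<Rightarrow> ('i \<Rightarrow> nat) \<Rightarrow> (('i \<Rightarrow> complex^3) \<Rightarrow> complex) \<Rightarrow> bool" where
  "multihomogeneous I e F \<longleftrightarrow> polynomial_fun I F \<and>
     (\<forall>x c. \<forall>i\<in>I. F (x(i := c *s x i)) = c ^ e i * F x)"

text \<open>The closed sets are the common zero loci of families of multihomogeneous polynomials,
  so the non-vanishing loci of single ones form a base of the open sets.\<close>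

definition nonvanishing_locus ::
  "'i set \<Rightarrow> (('i \<Rightarrow> complex^3) \<Rightarrow> complex) \<Rightarrow> ('i \<Rightarrow> cp2) set" where
  "nonvanishing_locus I F = {v \<in> cp2_pow I. \<forall>x\<in>hom_coords I v. F x \<noteq> 0}"

definition zariski :: "'i set \<Rightarrow> ('i \<Rightarrow> cp2) topology" where
  "zariski I = topology_generated_by
     {nonvanishing_locus I F | F. \<exists>e. multihomogeneous I e F}"

lemma topspace_zariski: "topspace (zariski I) = cp2_pow I"
proof -
  have "multihomogeneous I (\<lambda>_. 0) (\<lambda>_. 1)"
    by (auto simp: multihomogeneous_def intro: polynomial_fun.const)
  moreover have "nonvanishing_locus I (\<lambda>_. 1) = cp2_pow I"
    by (auto simp: nonvanishing_locus_def)
  ultimately have "cp2_pow I \<subseteq> topspace (zariski I)"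
    unfolding zariski_def topology_generated_by_topspace by blast
  moreover have "topspace (zariski I) \<subseteq> cp2_pow I"
    unfolding zariski_def topology_generated_by_topspace nonvanishing_locus_def by blast
  ultimately show ?thesis by blast
qed

definition zariski_dense :: "'i set \<Rightarrow> ('i \<Rightarrow> cp2) set \<Rightarrow> bool" where
  "zariski_dense I U \<longleftrightarrow> zariski I closure_of U = topspace (zariski I)"


section \<open>Rational maps\<close>

text \<open>Morphisms from an open set \<open>U\<close> to the power indexed by \<open>J\<close>: locally, every component is
  given by three multihomogeneous polynomials of equal multidegree without common zero.\<close>

definition regular_on ::
  "'i set \<Rightarrow> 'j set \<Rightarrow> ('i \<Rightarrow> cp2) set \<Rightarrow> (('i \<Rightarrow> cp2) \<Rightarrow> ('j \<Rightarrow> cp2)) \<Rightarrow> bool" where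
  "regular_on I J U f \<longleftrightarrow> openin (zariski I) U \<and> f ` U \<subseteq> cp2_pow J \<and>
     (\<forall>v\<in>U. \<forall>j\<in>J. \<exists>W e P. openin (zariski I) W \<and> v \<in> W \<and> W \<subseteq> U \<and>
        (\<forall>k::3. multihomogeneous I e (P k)) \<and>
        (\<forall>u\<in>W. \<forall>x\<in>hom_coords I u.
           (\<chi> k. P k x) \<noteq> 0 \<and> f u j = proj (\<chi> k. P k x)))"

text \<open>A pair \<open>(U, f)\<close> represents the rational map given by the morphism \<open>f\<close> on the dense open
  set \<open>U\<close>; two pairs represent the same rational map if they agree where both are defined.\<close>

type_synonym ('i, 'j) rat_rep = "('i \<Rightarrow> cp2) set \<times> (('i \<Rightarrow> cp2) \<Rightarrow> ('j \<Rightarrow> cp2))"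

definition rational_map :: "'i set \<Rightarrow> 'j set \<Rightarrow> ('i, 'j) rat_rep \<Rightarrow> bool" where
  "rational_map I J r \<longleftrightarrow> zariski_dense I (fst r) \<and> regular_on I J (fst r) (snd r)"

definition same_rational_map :: "('i, 'j) rat_rep \<Rightarrow> ('i, 'j) rat_rep \<Rightarrow> bool" where
  "same_rational_map r s \<longleftrightarrow> (\<forall>v \<in> fst r \<inter> fst s. snd r v = snd s v)"

text \<open>The graph of the maximal extension of the rational map. Its domain is the domain of
  definition: the union of the domains of all representatives.\<close>

definition rat_graph ::
  "'i set \<Rightarrow> 'j set \<Rightarrow> ('i, 'j) rat_rep \<Rightarrow> (('i \<Rightarrow> cp2) \<times> ('j \<Rightarrow> cp2)) set" where
  "rat_graph I J r =
     {(v, snd s v) | v s. rational_map I J s \<and> same_rational_map r s \<and> v \<in> fst s}"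

definition dominant :: "'i set \<Rightarrow> 'j set \<Rightarrow> ('i, 'j) rat_rep \<Rightarrow> bool" where
  "dominant I J r \<longleftrightarrow> rational_map I J r \<and> zariski_dense J (Range (rat_graph I J r))"

definition rat_fiber ::
  "'i set \<Rightarrow> 'j set \<Rightarrow> ('i, 'j) rat_rep \<Rightarrow> ('j \<Rightarrow> cp2) \<Rightarrow> ('i \<Rightarrow> cp2) set" where
  "rat_fiber I J r y = {v. (v, y) \<in> rat_graph I J r}"

text \<open>\<open>k\<close> is the generic topological degree. It is unique, since any two dense open sets
  intersect.\<close>

definition has_top_degree :: "'i set \<Rightarrow> 'j set \<Rightarrow> ('i, 'j) rat_rep \<Rightarrow> nat \<Rightarrow> bool" where
  "has_top_degree I J r k \<longleftrightarrow>
     (\<exists>U. openin (zariski J) U \<and> zariski_dense J U \<and>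
        (\<forall>y\<in>U. finite (rat_fiber I J r y) \<and> card (rat_fiber I J r y) = k))"


section \<open>Skew pentagram maps\<close>

text \<open>Indices modulo \<open>n\<close> are represented by \<open>{0..<n}\<close>.\<close>

abbreviation idx :: "nat \<Rightarrow> int set" where
  "idx n \<equiv> {0..<int n}"

text \<open>The vertex at an integer index taken modulo \<open>n\<close>.\<close>

definition vertex :: "nat \<Rightarrow> (int \<Rightarrow> cp2) \<Rightarrow> int \<Rightarrow> cp2" where
  "vertex n v i = v (i mod int n)"

text \<open>The polygons on which the geometric construction makes sense for every index.\<close>

definition skew_pentagram_dom ::
  "nat \<Rightarrow> int \<Rightarrow> int \<Rightarrow> int \<Rightarrow> int \<Rightarrow> (int \<Rightarrow> cp2) set" where
  "skew_pentagram_dom n a b c d = {v \<in> cp2_pow (idx n). \<forall>i\<in>idx n.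
     vertex n v (i + a) \<noteq> vertex n v (i + b) \<and>
     vertex n v (i + c) \<noteq> vertex n v (i + d) \<and>
     proj_line (vertex n v (i + a)) (vertex n v (i + b)) \<noteq>
     proj_line (vertex n v (i + c)) (vertex n v (i + d))}"

definition skew_pentagram_map ::
  "nat \<Rightarrow> int \<Rightarrow> int \<Rightarrow> int \<Rightarrow> int \<Rightarrow> (int, int) rat_rep" where
  "skew_pentagram_map n a b c d =
     (skew_pentagram_dom n a b c d,
      \<lambda>v. \<lambda>i\<in>idx n. the_elem
        (proj_line (vertex n v (i + a)) (vertex n v (i + b)) \<inter>
         proj_line (vertex n v (i + c)) (vertex n v (i + d))))"

end

theory Submission
  imports Defs "HOL-Computational_Algebra.Polynomial"
begin

text \<open>Take \<open>n = 6 g\<close> and let \<open>y\<close> be the image of \<open>v\<close> under the skew pentagram map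
  \<open>y\<^sub>i = v\<^sub>i v\<^sub>i\<^sub>+\<^sub>3\<^sub>g \<inter> v\<^sub>i\<^sub>+\<^sub>2\<^sub>g v\<^sub>i\<^sub>+\<^sub>4\<^sub>g\<close>. The first of the two lines is the same for \<open>i\<close> and for
  \<open>i + 3 g\<close>, so \<open>y\<close> determines it as \<open>y\<^sub>i y\<^sub>i\<^sub>+\<^sub>3\<^sub>g\<close>: every vertex of \<open>v\<close> is confined to a known line.
  What is left is that the second line passes through \<open>y\<^sub>i\<close>, and this relates only
  vertices whose indices agree modulo \<open>2 g\<close>. For each of these \<open>2 g\<close> classes one has to find a
  triangle \<open>v\<^sub>i, v\<^sub>i\<^sub>+\<^sub>2\<^sub>g, v\<^sub>i\<^sub>+\<^sub>4\<^sub>g\<close> with its vertices on three given lines and its sides through three given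
  points. Going once around the triangle, the three projections between the lines compose to a
  projectivity of one line with itself, and its two fixed points give exactly two triangles
  (\<open>card_inscribed\<close>). The choices in different classes are independent, so a generic fiber has
  \<open>2\<^sup>2\<^sup>g\<close> elements (\<open>card_incidence\<close>), which is unbounded. Here the differences of the
  two index pairs are \<open>3 g\<close> and \<open>2 g\<close>, so the map is truly skew.

  The fibers in question are those of the maximal extension of the map, where the geometric
  construction may break down. Nevertheless a polynomial relation between \<open>v\<close> and its image that holds
  on the geometric domain holds on the whole domain of definition, because nonempty open sets are
  dense (\<open>rat_graph_closed_relation\<close>). It pays to choose the relations with care: the collinearity of
  \<open>v\<^sub>i, v\<^sub>i\<^sub>+\<^sub>3\<^sub>g, y\<^sub>i\<close> is void when \<open>v\<^sub>i = v\<^sub>i\<^sub>+\<^sub>3\<^sub>g\<close>, whereas the collinearity of \<open>v\<^sub>i, y\<^sub>i, y\<^sub>i\<^sub>+\<^sub>3\<^sub>g\<close> keeps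
  \<open>v\<^sub>i\<close> on a line in all cases. The latter, together with the collinearity of
  \<open>v\<^sub>i\<^sub>+\<^sub>2\<^sub>g, v\<^sub>i\<^sub>+\<^sub>4\<^sub>g, y\<^sub>i\<close>, cuts out the fiber over a generic \<open>y\<close> exactly (\<open>rat_fiber_generic\<close>).

  For this one must know that no solution for a generic \<open>y\<close> is degenerate. A triangle is
  nondegenerate unless its three lines are concurrent, a condition in the style of Ceva
  (\<open>inscribed_not_collinear3\<close>). The vertices \<open>v\<^sub>i\<close> and \<open>v\<^sub>i\<^sub>+\<^sub>3\<^sub>g\<close> belong to different triangles but to the
  same line; each is a root of a quadratic form on it, so they are distinct if the
  resultant of the two forms does not vanish (\<open>inscribed_disjoint\<close>). All genericity assumptions are thus
  collected in one multihomogeneous polynomial, and a numerical example shows that it is not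
  identically zero.\<close>


section \<open>Incidence in the complex projective plane\<close>

definition det3 :: "complex^3 \<Rightarrow> complex^3 \<Rightarrow> complex^3 \<Rightarrow> complex" where
  "det3 x y z = x$1 * (y$2 * z$3 - y$3 * z$2) - x$2 * (y$1 * z$3 - y$3 * z$1)
     + x$3 * (y$1 * z$2 - y$2 * z$1)"

definition ccross :: "complex^3 \<Rightarrow> complex^3 \<Rightarrow> complex^3" where
  "ccross x y = vector [x$2 * y$3 - x$3 * y$2, x$3 * y$1 - x$1 * y$3, x$1 * y$2 - x$2 * y$1]"

lemma ccross_nth [simp]:
  "ccross x y $ 1 = x$2 * y$3 - x$3 * y$2"
  "ccross x y $ 2 = x$3 * y$1 - x$1 * y$3"
  "ccross x y $ 3 = x$1 * y$2 - x$2 * y$1"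
  by (simp_all add: ccross_def)

lemma vec3_eq_iff: "x = y \<longleftrightarrow> x$1 = y$1 \<and> x$2 = y$2 \<and> x$3 = y$3" for x y :: "complex^3"
  by (simp add: vec_eq_iff forall_3)

lemma ccross_scale: "ccross (c *s x) y = c *s ccross x y" "ccross x (c *s y) = c *s ccross x y"
  by (simp_all add: vec3_eq_iff algebra_simps)

lemma det3_scale:
  "det3 (c *s x) y z = c * det3 x y z"
  "det3 x (c *s y) z = c * det3 x y z"
  "det3 x y (c *s z) = c * det3 x y z"
  by (simp_all add: det3_def algebra_simps)

lemma ccross_eq_0_iff:
  assumes "x \<noteq> 0" "y \<noteq> 0"
  shows "ccross x y = 0 \<longleftrightarrow> (\<exists>c. c \<noteq> 0 \<and> y = c *s x)"
proof
  assume "ccross x y = 0"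
  hence e: "x$2 * y$3 = x$3 * y$2" "x$3 * y$1 = x$1 * y$3" "x$1 * y$2 = x$2 * y$1"
    by (simp_all add: vec3_eq_iff)
  from \<open>x \<noteq> 0\<close> consider "x$1 \<noteq> 0" | "x$2 \<noteq> 0" | "x$3 \<noteq> 0" by (auto simp: vec3_eq_iff)
  hence "\<exists>c. y = c *s x"
  proof cases
    case 1 with e show ?thesis
      by (intro exI[of _ "y$1 / x$1"]) (auto simp: vec3_eq_iff field_simps)
  next
    case 2 with e show ?thesis
      by (intro exI[of _ "y$2 / x$2"]) (auto simp: vec3_eq_iff field_simps)
  next
    case 3 with e show ?thesis
      by (intro exI[of _ "y$3 / x$3"]) (auto simp: vec3_eq_iff field_simps)
  qed
  with \<open>y \<noteq> 0\<close> show "\<exists>c. c \<noteq> 0 \<and> y = c *s x" by (metis vector_smult_lzero)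
qed (auto simp: vec3_eq_iff)

lemma Rep_cp2_proj: "x \<noteq> 0 \<Longrightarrow> Rep_cp2 (proj x) = vec.span {x}"
  unfolding proj_def by (rule Abs_cp2_inverse) blast

lemma ex_proj: "\<exists>x. x \<noteq> 0 \<and> proj x = p"
  by (cases p rule: Abs_cp2_cases) (auto simp: proj_def)

lemma proj_eq_iff:
  assumes "x \<noteq> 0" "y \<noteq> 0"
  shows "proj x = proj y \<longleftrightarrow> ccross x y = 0"
proof -
  have "proj x = proj y \<longleftrightarrow> vec.span {x} = vec.span {y}"
    using assms by (metis Rep_cp2_inject Rep_cp2_proj)
  also have "\<dots> \<longleftrightarrow> (\<exists>c. c \<noteq> 0 \<and> y = c *s x)"
  proof
    assume "vec.span {x} = vec.span {y}"
    hence "y \<in> vec.span {x}" by (simp add: vec.span_base)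
    then obtain c where "y = c *s x" by (auto simp: vec.span_singleton)
    with assms show "\<exists>c. c \<noteq> 0 \<and> y = c *s x" by (metis vector_smult_lzero)
  next
    assume "\<exists>c. c \<noteq> 0 \<and> y = c *s x"
    then obtain c where c: "c \<noteq> 0" "y = c *s x" by blast
    have "k *s x = (k / c) *s y" for k using c by (simp add: vector_smult_assoc)
    moreover have "k *s y = (k * c) *s x" for k using c by (simp add: vector_smult_assoc)
    ultimately show "vec.span {x} = vec.span {y}"
      unfolding vec.span_singleton by (metis (no_types, lifting) rangeE rangeI subsetI subset_antisym)
  qed
  finally show ?thesis using ccross_eq_0_iff[OF assms] by simp
qed

lemma proj_scale: "c \<noteq> 0 \<Longrightarrow> x \<noteq> 0 \<Longrightarrow> proj (c *s x) = proj x"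
  by (subst proj_eq_iff) (auto simp: vec3_eq_iff)

lemma proj_eqD:
  assumes "proj x = proj y" "x \<noteq> 0" "y \<noteq> 0"
  obtains c where "c \<noteq> 0" "y = c *s x"
  using assms proj_eq_iff ccross_eq_0_iff by blast

lemma in_proj_line_iff:
  assumes "x \<noteq> 0" "y \<noteq> 0" "z \<noteq> 0"
  shows "proj z \<in> proj_line (proj x) (proj y) \<longleftrightarrow> (\<exists>a b. z = a *s x + b *s y)"
proof -
  have "vec.span (vec.span {x} \<union> vec.span {y}) = {a *s x + b *s y | a b. True}"
    unfolding vec.span_Un vec.span_span unfolding vec.span_singleton by blast
  hence "proj z \<in> proj_line (proj x) (proj y) \<longleftrightarrow> vec.span {z} \<subseteq> {a *s x + b *s y | a b. True}"
    using assms by (simp add: proj_line_def Rep_cp2_proj)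
  also have "\<dots> \<longleftrightarrow> (\<exists>a b. z = a *s x + b *s y)"
  proof
    assume "vec.span {z} \<subseteq> {a *s x + b *s y | a b. True}"
    moreover have "z \<in> vec.span {z}" by (simp add: vec.span_base)
    ultimately show "\<exists>a b. z = a *s x + b *s y" by blast
  next
    assume "\<exists>a b. z = a *s x + b *s y"
    then obtain a b where "z = a *s x + b *s y" by blast
    hence "k *s z = (k * a) *s x + (k * b) *s y" for k
      by (simp add: vec3_eq_iff algebra_simps)
    thus "vec.span {z} \<subseteq> {a *s x + b *s y | a b. True}"
      by (auto simp: vec.span_singleton)
  qed
  finally show ?thesis .
qed

lemma det3_eq_0_imp_combination:
  assumes "ccross x y \<noteq> 0" "det3 x y z = 0"
  shows "\<exists>a b. z = a *s x + b *s y"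
proof -
  have div: ?thesis if "d \<noteq> 0" "d *s z = a *s x + b *s y" for d a b
  proof -
    have "z = (1 / d) *s (d *s z)" using that(1) by (simp add: vector_smult_assoc)
    also have "\<dots> = (a / d) *s x + (b / d) *s y"
      unfolding that(2) by (simp add: vector_add_ldistrib vector_smult_assoc)
    finally show ?thesis by blast
  qed
  from assms(1) consider "ccross x y $ 1 \<noteq> 0" | "ccross x y $ 2 \<noteq> 0" | "ccross x y $ 3 \<noteq> 0"
    unfolding vec3_eq_iff by auto
  thus ?thesis
  proof cases
    case 1
    have "ccross x y $ 1 *s z = ccross z y $ 1 *s x + ccross x z $ 1 *s y + det3 x y z *s vector [1,0,0]"
      by (simp add: vec3_eq_iff det3_def algebra_simps)
    hence "ccross x y $ 1 *s z = ccross z y $ 1 *s x + ccross x z $ 1 *s y"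
      using assms(2) by simp
    with 1 show ?thesis by (rule div)
  next
    case 2
    have "ccross x y $ 2 *s z = ccross z y $ 2 *s x + ccross x z $ 2 *s y + det3 x y z *s vector [0,1,0]"
      by (simp add: vec3_eq_iff det3_def algebra_simps)
    hence "ccross x y $ 2 *s z = ccross z y $ 2 *s x + ccross x z $ 2 *s y"
      using assms(2) by simp
    with 2 show ?thesis by (rule div)
  next
    case 3
    have "ccross x y $ 3 *s z = ccross z y $ 3 *s x + ccross x z $ 3 *s y + det3 x y z *s vector [0,0,1]"
      by (simp add: vec3_eq_iff det3_def algebra_simps)
    hence "ccross x y $ 3 *s z = ccross z y $ 3 *s x + ccross x z $ 3 *s y"
      using assms(2) by simp
    with 3 show ?thesis by (rule div)
  qed
qed

lemma in_proj_line_iff_det3: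
  assumes "x \<noteq> 0" "y \<noteq> 0" "z \<noteq> 0" "proj x \<noteq> proj y"
  shows "proj z \<in> proj_line (proj x) (proj y) \<longleftrightarrow> det3 x y z = 0"
proof -
  have "det3 x y (a *s x + b *s y) = 0" for a b by (simp add: det3_def algebra_simps)
  moreover have "ccross x y \<noteq> 0" using assms proj_eq_iff by simp
  ultimately show ?thesis
    using in_proj_line_iff[OF assms(1-3)] det3_eq_0_imp_combination[of x y z] by auto
qed

definition collinear3 :: "cp2 \<Rightarrow> cp2 \<Rightarrow> cp2 \<Rightarrow> bool" where
  "collinear3 p q r \<longleftrightarrow> (\<exists>x y z. x \<noteq> 0 \<and> y \<noteq> 0 \<and> z \<noteq> 0 \<and>
     p = proj x \<and> q = proj y \<and> r = proj z \<and> det3 x y z = 0)"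

lemma collinear3_proj_iff:
  assumes "x \<noteq> 0" "y \<noteq> 0" "z \<noteq> 0"
  shows "collinear3 (proj x) (proj y) (proj z) \<longleftrightarrow> det3 x y z = 0"
proof
  assume "collinear3 (proj x) (proj y) (proj z)"
  then obtain x' y' z' where "x' \<noteq> 0" "y' \<noteq> 0" "z' \<noteq> 0" "proj x' = proj x" "proj y' = proj y"
    "proj z' = proj z" and d: "det3 x' y' z' = 0" unfolding collinear3_def by metis
  then obtain a b c where "x = a *s x'" "y = b *s y'" "z = c *s z'"
    using assms by (metis proj_eqD)
  with d show "det3 x y z = 0" by (simp add: det3_scale)
qed (use assms in \<open>auto simp: collinear3_def\<close>)

lemma collinear3_swap: "collinear3 p q r \<Longrightarrow> collinear3 q p r" "collinear3 p q r \<Longrightarrow> collinear3 p r q"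
proof -
  assume "collinear3 p q r"
  then obtain x y z where *: "x \<noteq> 0" "y \<noteq> 0" "z \<noteq> 0" "p = proj x" "q = proj y" "r = proj z"
    "det3 x y z = 0" unfolding collinear3_def by blast
  have "det3 y x z = - det3 x y z" "det3 x z y = - det3 x y z"
    by (simp_all add: det3_def algebra_simps)
  with * show "collinear3 q p r" "collinear3 p r q" by (simp_all add: collinear3_proj_iff)
qed

lemma collinear3_refl: "collinear3 p q p" "collinear3 p q q"
proof -
  obtain x where x: "x \<noteq> 0" "proj x = p" using ex_proj by blast
  obtain y where y: "y \<noteq> 0" "proj y = q" using ex_proj by blast
  have d: "det3 x y x = 0" "det3 x y y = 0" by (simp_all add: det3_def algebra_simps)
  show "collinear3 p q p" using collinear3_proj_iff[OF x(1) y(1) x(1)] d x y by simp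
  show "collinear3 p q q" using collinear3_proj_iff[OF x(1) y(1) y(1)] d x y by simp
qed

lemma in_proj_line_iff_collinear3: "p \<noteq> q \<Longrightarrow> r \<in> proj_line p q \<longleftrightarrow> collinear3 p q r"
proof -
  assume pq: "p \<noteq> q"
  obtain x where x: "x \<noteq> 0" "proj x = p" using ex_proj by blast
  obtain y where y: "y \<noteq> 0" "proj y = q" using ex_proj by blast
  obtain z where z: "z \<noteq> 0" "proj z = r" using ex_proj by blast
  show ?thesis
    using in_proj_line_iff_det3[OF x(1) y(1) z(1)] collinear3_proj_iff[OF x(1) y(1) z(1)] x y z pq by simp
qed

lemma collinear3_trans:
  assumes "p \<noteq> q" "collinear3 p q r" "collinear3 p q s" "collinear3 p q t"
  shows "collinear3 r s t"
proof -
  obtain x where x: "x \<noteq> 0" "proj x = p" using ex_proj by blast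
  obtain y where y: "y \<noteq> 0" "proj y = q" using ex_proj by blast
  obtain z where z: "z \<noteq> 0" "proj z = r" using ex_proj by blast
  obtain u where u: "u \<noteq> 0" "proj u = s" using ex_proj by blast
  obtain w where w: "w \<noteq> 0" "proj w = t" using ex_proj by blast
  have c: "ccross x y \<noteq> 0" using assms(1) x y proj_eq_iff[OF x(1) y(1)] by simp
  have d: "det3 x y z = 0" "det3 x y u = 0" "det3 x y w = 0"
    using assms(2-) collinear3_proj_iff[OF x(1) y(1) z(1)] collinear3_proj_iff[OF x(1) y(1) u(1)]
      collinear3_proj_iff[OF x(1) y(1) w(1)] x y z u w by simp_all
  obtain a b where "z = a *s x + b *s y" using det3_eq_0_imp_combination c d by blast
  moreover obtain a' b' where "u = a' *s x + b' *s y" using det3_eq_0_imp_combination c d by blast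
  moreover obtain a'' b'' where "w = a'' *s x + b'' *s y" using det3_eq_0_imp_combination c d by blast
  ultimately have "det3 z u w = 0" by (simp add: det3_def algebra_simps)
  thus ?thesis using collinear3_proj_iff[OF z(1) u(1) w(1)] z u w by simp
qed

text \<open>The double cross product detects all three ways in which two spanned lines can fail to have a
  unique intersection point, and it gives that point otherwise. This makes the geometric
  construction polynomial.\<close>

lemma lines_meet:
  assumes nz: "x1 \<noteq> 0" "x2 \<noteq> 0" "x3 \<noteq> 0" "x4 \<noteq> 0"
  defines "w \<equiv> ccross (ccross x1 x2) (ccross x3 x4)"
  shows "w \<noteq> 0 \<longleftrightarrow> proj x1 \<noteq> proj x2 \<and> proj x3 \<noteq> proj x4 \<and>
           proj_line (proj x1) (proj x2) \<noteq> proj_line (proj x3) (proj x4)"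
    and "w \<noteq> 0 \<Longrightarrow>
           proj_line (proj x1) (proj x2) \<inter> proj_line (proj x3) (proj x4) = {proj w}"
proof -
  have w1: "w = det3 x3 x4 x1 *s x2 - det3 x3 x4 x2 *s x1"
    by (simp add: w_def det3_def vec3_eq_iff algebra_simps)
  have w2: "w = det3 x1 x2 x4 *s x3 - det3 x1 x2 x3 *s x4"
    by (simp add: w_def det3_def vec3_eq_iff algebra_simps)
  have dz: "ccross z w = det3 x3 x4 z *s ccross x1 x2 - det3 x1 x2 z *s ccross x3 x4" for z
    by (simp add: w_def det3_def vec3_eq_iff algebra_simps)
  have dist: "proj x1 \<noteq> proj x2" "proj x3 \<noteq> proj x4" if "w \<noteq> 0"
    using that nz by (auto simp: proj_eq_iff w_def vec3_eq_iff)
  have self: "proj x1 \<in> proj_line (proj x1) (proj x2)" "proj x2 \<in> proj_line (proj x1) (proj x2)"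
    if "proj x1 \<noteq> proj x2"
    using that nz by (auto simp: in_proj_line_iff_det3 det3_def algebra_simps)
  show inter: "proj_line (proj x1) (proj x2) \<inter> proj_line (proj x3) (proj x4) = {proj w}" if "w \<noteq> 0"
  proof -
    have "det3 x1 x2 w = 0" "det3 x3 x4 w = 0"
      by (simp_all add: w_def det3_def algebra_simps)
    hence "proj w \<in> proj_line (proj x1) (proj x2) \<inter> proj_line (proj x3) (proj x4)"
      using dist[OF that] that nz by (simp add: in_proj_line_iff_det3)
    moreover have "p = proj w"
      if p: "p \<in> proj_line (proj x1) (proj x2) \<inter> proj_line (proj x3) (proj x4)" for p
    proof -
      obtain z where z: "z \<noteq> 0" "proj z = p" using ex_proj by blast
      have "det3 x1 x2 z = 0"
        using p in_proj_line_iff_det3[OF nz(1,2) z(1) dist(1)[OF \<open>w \<noteq> 0\<close>]] z by simp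
      moreover have "det3 x3 x4 z = 0"
        using p in_proj_line_iff_det3[OF nz(3,4) z(1) dist(2)[OF \<open>w \<noteq> 0\<close>]] z by simp
      ultimately have "ccross z w = 0" using dz by simp
      thus ?thesis using proj_eq_iff[OF z(1) \<open>w \<noteq> 0\<close>] z by simp
    qed
    ultimately show ?thesis by blast
  qed
  show "w \<noteq> 0 \<longleftrightarrow> proj x1 \<noteq> proj x2 \<and> proj x3 \<noteq> proj x4 \<and>
           proj_line (proj x1) (proj x2) \<noteq> proj_line (proj x3) (proj x4)"
  proof (intro iffI conjI dist)
    assume "w \<noteq> 0"
    show "proj_line (proj x1) (proj x2) \<noteq> proj_line (proj x3) (proj x4)"
      using self dist[OF \<open>w \<noteq> 0\<close>] inter[OF \<open>w \<noteq> 0\<close>] by auto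
  next
    assume a: "proj x1 \<noteq> proj x2 \<and> proj x3 \<noteq> proj x4 \<and>
           proj_line (proj x1) (proj x2) \<noteq> proj_line (proj x3) (proj x4)"
    show "w \<noteq> 0"
    proof
      assume "w = 0"
      have "det3 x3 x4 x1 *s ccross x1 x2 = ccross x1 w" "det3 x3 x4 x2 *s ccross x1 x2 = ccross x2 w"
        by (simp_all add: w_def det3_def vec3_eq_iff algebra_simps)
      moreover have "ccross u 0 = 0" for u by (simp add: vec3_eq_iff)
      ultimately have 1: "det3 x3 x4 x1 = 0" "det3 x3 x4 x2 = 0"
        using a nz by (simp_all add: \<open>w = 0\<close> proj_eq_iff vector_mul_eq_0)
      have c: "collinear3 (proj x3) (proj x4) (proj x1)" "collinear3 (proj x3) (proj x4) (proj x2)"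
        using 1 nz by (simp_all add: collinear3_proj_iff)
      have "collinear3 (proj x3) (proj x4) r \<longleftrightarrow> collinear3 (proj x1) (proj x2) r" for r
      proof
        assume "collinear3 (proj x3) (proj x4) r"
        thus "collinear3 (proj x1) (proj x2) r" using collinear3_trans[OF _ c] a by simp
      next
        assume r: "collinear3 (proj x1) (proj x2) r"
        have "collinear3 (proj x1) (proj x2) (proj x3)" "collinear3 (proj x1) (proj x2) (proj x4)"
          using collinear3_trans[OF _ c] a collinear3_refl by simp_all
        thus "collinear3 (proj x3) (proj x4) r" using r collinear3_trans[of "proj x1" "proj x2"] a by simp
      qed
      hence "proj_line (proj x1) (proj x2) = proj_line (proj x3) (proj x4)"
        using a by (simp add: set_eq_iff in_proj_line_iff_collinear3)
      thus False using a by blast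
    qed
  qed
qed


section \<open>Polynomial functions and Zariski density\<close>

lemma polynomial_fun_sub:
  assumes "polynomial_fun I F" "polynomial_fun I G"
  shows "polynomial_fun I (\<lambda>x. F x - G x)"
  using polynomial_fun.add[OF assms(1) polynomial_fun.mult[OF polynomial_fun.const[of I "-1"] assms(2)]]
  by simp

lemma polynomial_fun_power:
  "polynomial_fun I F \<Longrightarrow> polynomial_fun I (\<lambda>x. F x ^ m)"
  by (induction m) (auto intro: polynomial_fun.intros)

lemma polynomial_fun_prod:
  assumes "finite A" "\<And>a. a \<in> A \<Longrightarrow> polynomial_fun I (F a)"
  shows "polynomial_fun I (\<lambda>x. \<Prod>a\<in>A. F a x)"
  using assms by (induction A rule: finite_induct) (auto intro: polynomial_fun.intros)

lemmas polynomial_fun_intros =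
  polynomial_fun.intros polynomial_fun_sub polynomial_fun_power polynomial_fun_prod

lemma polynomial_fun_cong:
  assumes "polynomial_fun I F" "\<And>i. i \<in> I \<Longrightarrow> x i = y i"
  shows "F x = F y"
  using assms by (induction) auto

text \<open>Restriction to a line reduces questions about nonvanishing to polynomials in one variable.\<close>

lemma polynomial_fun_on_line:
  assumes "polynomial_fun I F"
  shows "\<exists>p. \<forall>t. poly p t = F (\<lambda>i. x i + t *s (y i - x i))"
  using assms
proof induction
  case (const c)
  show ?case by (rule exI[of _ "[:c:]"]) simp
next
  case (coord i k)
  show ?case by (rule exI[of _ "[:x i $ k, y i $ k - x i $ k:]"]) (simp add: algebra_simps)
next
  case (add F G)
  then obtain p q where "\<forall>t. poly p t = F (\<lambda>i. x i + t *s (y i - x i))"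
    "\<forall>t. poly q t = G (\<lambda>i. x i + t *s (y i - x i))" by blast
  thus ?case by (intro exI[of _ "p + q"]) simp
next
  case (mult F G)
  then obtain p q where "\<forall>t. poly p t = F (\<lambda>i. x i + t *s (y i - x i))"
    "\<forall>t. poly q t = G (\<lambda>i. x i + t *s (y i - x i))" by blast
  thus ?case by (intro exI[of _ "p * q"]) simp
qed

text \<open>The ring of polynomial functions is a domain: on the line joining a point where \<open>F\<close> is nonzero to
  a point where \<open>G\<close> is nonzero, both restrictions are nonzero polynomials with finitely many roots.\<close>

lemma polynomial_fun_mult_nonzero:
  assumes F: "polynomial_fun I F" "F x \<noteq> 0" and G: "polynomial_fun I G" "G y \<noteq> 0"
  shows "\<exists>z. F z * G z \<noteq> 0"
proof -
  obtain p where p: "\<And>t. poly p t = F (\<lambda>i. x i + t *s (y i - x i))"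
    using polynomial_fun_on_line[OF F(1)] by blast
  obtain q where q: "\<And>t. poly q t = G (\<lambda>i. x i + t *s (y i - x i))"
    using polynomial_fun_on_line[OF G(1)] by blast
  have "poly p 0 \<noteq> 0" "poly q 1 \<noteq> 0" using F G by (simp_all add: p q)
  hence "p * q \<noteq> 0" by auto
  hence "finite {t. poly (p * q) t = 0}" by (rule poly_roots_finite)
  then obtain t where "poly (p * q) t \<noteq> 0"
    using infinite_UNIV_char_0[where 'a = complex] by (metis (mono_tags, lifting) finite_subset mem_Collect_eq subsetI)
  thus ?thesis by (auto simp: p q)
qed

lemma polynomial_fun_prod_nonzero:
  assumes "finite A" "\<And>a. a \<in> A \<Longrightarrow> polynomial_fun I (F a)" "\<And>a. a \<in> A \<Longrightarrow> \<exists>x. F a x \<noteq> 0"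
  shows "\<exists>x. (\<Prod>a\<in>A. F a x) \<noteq> 0"
  using assms
proof (induction A rule: finite_induct)
  case (insert a A)
  have p: "polynomial_fun I (\<lambda>x. \<Prod>a\<in>A. F a x)" using insert by (intro polynomial_fun_prod) auto
  obtain x where x: "F a x \<noteq> 0" using insert.prems(2) by blast
  obtain y where y: "(\<Prod>a\<in>A. F a y) \<noteq> 0" using insert by blast
  have "\<exists>z. F a z * (\<Prod>a\<in>A. F a z) \<noteq> 0"
    using polynomial_fun_mult_nonzero[OF insert.prems(1) x p y] by simp
  thus ?case using insert.hyps by simp
qed auto

text \<open>A point at which a polynomial is nonzero need not be a system of homogeneous coordinates, since some
  of its triples may vanish; multiplying by one coordinate of each triple excludes this.\<close>

lemma polynomial_fun_nonzero_at_hom_coords: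
  assumes "finite I" "polynomial_fun I F" "F x \<noteq> 0"
  shows "\<exists>z. F z \<noteq> 0 \<and> (\<forall>i\<in>I. z i \<noteq> 0)"
proof -
  define C where "C = (\<lambda>i (y :: 'a \<Rightarrow> complex^3). y i $ 1)"
  have C: "polynomial_fun I (C i)" if "i \<in> I" for i
    using polynomial_fun.coord[OF that, of 1] by (simp add: C_def)
  have "C i (\<lambda>_. \<chi> k. 1) \<noteq> 0" for i by (simp add: C_def)
  hence "\<exists>y. C i y \<noteq> 0" for i by blast
  hence "\<exists>y. (\<Prod>i\<in>I. C i y) \<noteq> 0"
    using polynomial_fun_prod_nonzero[of I I C, OF assms(1) C] by simp
  then obtain y where y: "(\<Prod>i\<in>I. C i y) \<noteq> 0" ..
  have pC: "polynomial_fun I (\<lambda>y. \<Prod>i\<in>I. C i y)" by (intro polynomial_fun_prod assms C)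
  then obtain z where z: "F z * (\<Prod>i\<in>I. C i z) \<noteq> 0"
    using polynomial_fun_mult_nonzero[OF assms(2,3) pC y] by blast
  hence "\<forall>i\<in>I. z i $ 1 \<noteq> 0" using assms(1) by (auto simp: C_def)
  hence "\<forall>i\<in>I. z i \<noteq> 0" by auto
  thus ?thesis using z by auto
qed

lemma multihomogeneous_mult:
  assumes "multihomogeneous I e F" "multihomogeneous I e' G"
  shows "multihomogeneous I (\<lambda>i. e i + e' i) (\<lambda>x. F x * G x)"
  using assms by (auto simp: multihomogeneous_def power_add intro: polynomial_fun.mult)

lemma multihomogeneous_prod:
  assumes "finite A" "\<And>a. a \<in> A \<Longrightarrow> multihomogeneous I (e a) (F a)"
  shows "multihomogeneous I (\<lambda>i. \<Sum>a\<in>A. e a i) (\<lambda>x. \<Prod>a\<in>A. F a x)"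
  using assms
proof (induction A rule: finite_induct)
  case empty show ?case by (simp add: multihomogeneous_def polynomial_fun.const)
qed (simp add: multihomogeneous_mult)

lemma hom_coords_nonempty: "\<exists>x. x \<in> hom_coords I v"
proof -
  have "\<forall>p. \<exists>x. x \<noteq> 0 \<and> proj x = p" using ex_proj by blast
  then obtain x where "\<forall>p. x p \<noteq> 0 \<and> proj (x p) = p" by (rule choice[THEN exE])
  hence "(\<lambda>i. x (v i)) \<in> hom_coords I v" by (auto simp: hom_coords_def)
  thus ?thesis by blast
qed

lemma hom_coords_proj:
  "(\<And>i. i \<in> I \<Longrightarrow> x i \<noteq> 0) \<Longrightarrow> x \<in> hom_coords I (\<lambda>i\<in>I. proj (x i))"
  by (simp add: hom_coords_def)

text \<open>Two coordinate systems of the same point differ by nonzero scalars, which are exchanged here one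
  index at a time.\<close>

lemma multihomogeneous_indep_coords:
  assumes "finite I" "multihomogeneous I e F" "x \<in> hom_coords I v" "y \<in> hom_coords I v" "F x \<noteq> 0"
  shows "F y \<noteq> 0"
proof -
  have "\<exists>c. c \<noteq> 0 \<and> y i = c *s x i" if "i \<in> I" for i
  proof -
    have "proj (x i) = proj (y i)" "x i \<noteq> 0" "y i \<noteq> 0"
      using assms(3,4) that by (auto simp: hom_coords_def)
    then obtain c where "c \<noteq> 0" "y i = c *s x i" by (rule proj_eqD)
    thus ?thesis by blast
  qed
  then obtain c where c: "\<And>i. i \<in> I \<Longrightarrow> c i \<noteq> 0 \<and> y i = c i *s x i" by metis
  have "F (\<lambda>i. if i \<in> J then y i else x i) \<noteq> 0" if "J \<subseteq> I" for J
    using finite_subset[OF that assms(1)] that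
  proof (induction J rule: finite_induct)
    case empty with assms(5) show ?case by simp
  next
    case (insert j J)
    let ?z = "\<lambda>i. if i \<in> J then y i else x i"
    have "(\<lambda>i. if i \<in> insert j J then y i else x i) = ?z(j := c j *s ?z j)"
      using insert c by auto
    moreover have "F (?z(j := c j *s ?z j)) = c j ^ e j * F ?z"
      using assms(2) insert.prems unfolding multihomogeneous_def by blast
    ultimately show ?case using insert c[of j] by simp
  qed
  from this[of I] have "F (\<lambda>i. if i \<in> I then y i else x i) \<noteq> 0" by simp
  moreover have "F (\<lambda>i. if i \<in> I then y i else x i) = F y"
    using assms(2) by (intro polynomial_fun_cong) (auto simp: multihomogeneous_def)
  ultimately show ?thesis by simp
qed

lemma in_nonvanishing_locus_iff:
  assumes "finite I" "multihomogeneous I e F" "x \<in> hom_coords I v" "v \<in> cp2_pow I"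
  shows "v \<in> nonvanishing_locus I F \<longleftrightarrow> F x \<noteq> 0"
proof
  assume "v \<in> nonvanishing_locus I F"
  thus "F x \<noteq> 0" using assms(3) unfolding nonvanishing_locus_def by blast
next
  assume "F x \<noteq> 0"
  hence "\<forall>y\<in>hom_coords I v. F y \<noteq> 0"
    using multihomogeneous_indep_coords[OF assms(1-3)] by blast
  thus "v \<in> nonvanishing_locus I F" using assms(4) unfolding nonvanishing_locus_def by blast
qed

lemma openin_nonvanishing_locus:
  "multihomogeneous I e F \<Longrightarrow> openin (zariski I) (nonvanishing_locus I F)"
  unfolding zariski_def by (rule topology_generated_by_Basis) blast

text \<open>The generating sets are closed under intersection, as products of multihomogeneous polynomials are
  multihomogeneous.\<close>

lemma zariski_base:
  assumes "openin (zariski I) U" "v \<in> U"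
  shows "\<exists>F e. multihomogeneous I e F \<and> v \<in> nonvanishing_locus I F \<and> nonvanishing_locus I F \<subseteq> U"
proof -
  have "generate_topology_on {nonvanishing_locus I F | F. \<exists>e. multihomogeneous I e F} U"
    using assms(1) unfolding zariski_def by (rule openin_topology_generated_by)
  thus ?thesis using assms(2)
  proof induction
    case (Int U V)
    then obtain F e G e' where F: "multihomogeneous I e F" "v \<in> nonvanishing_locus I F" "nonvanishing_locus I F \<subseteq> U"
      and G: "multihomogeneous I e' G" "v \<in> nonvanishing_locus I G" "nonvanishing_locus I G \<subseteq> V"
      by (metis IntD1 IntD2)
    have "nonvanishing_locus I (\<lambda>x. F x * G x) = nonvanishing_locus I F \<inter> nonvanishing_locus I G"
      by (auto simp: nonvanishing_locus_def)
    with F G multihomogeneous_mult[OF F(1) G(1)] show ?case by blast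
  qed blast+
qed

lemma zariski_dense_iff:
  "zariski_dense I U \<longleftrightarrow> (\<forall>W. openin (zariski I) W \<and> W \<noteq> {} \<longrightarrow> U \<inter> W \<noteq> {})"
  unfolding zariski_dense_def by (rule dense_intersects_open)

lemma zariski_dense_mono:
  "zariski_dense I U \<Longrightarrow> U \<subseteq> V \<Longrightarrow> zariski_dense I V"
  unfolding zariski_dense_iff by blast

lemma nonvanishing_locusD:
  assumes "v \<in> nonvanishing_locus I F"
  shows "\<exists>x. F x \<noteq> 0"
  using assms hom_coords_nonempty unfolding nonvanishing_locus_def by blast

text \<open>Irreducibility of a product of projective planes, from the fact that the polynomial functions form
  a domain.\<close>

lemma nonempty_open_dense:
  assumes I: "finite I" and U: "openin (zariski I) U" "U \<noteq> {}"
  shows "zariski_dense I U"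
  unfolding zariski_dense_iff
proof safe
  fix W w assume W: "openin (zariski I) W" "w \<in> W" "U \<inter> W = {}"
  obtain u where "u \<in> U" using U by blast
  then obtain F e where F: "multihomogeneous I e F" "u \<in> nonvanishing_locus I F" "nonvanishing_locus I F \<subseteq> U"
    using zariski_base U by meson
  obtain G e' where G: "multihomogeneous I e' G" "w \<in> nonvanishing_locus I G" "nonvanishing_locus I G \<subseteq> W"
    using zariski_base W by meson
  let ?H = "\<lambda>x. F x * G x"
  have pFG: "polynomial_fun I F" "polynomial_fun I G" using F G by (auto simp: multihomogeneous_def)
  obtain x y where "F x \<noteq> 0" "G y \<noteq> 0"
    using nonvanishing_locusD[OF F(2)] nonvanishing_locusD[OF G(2)] by blast
  then obtain z' where "?H z' \<noteq> 0" using polynomial_fun_mult_nonzero pFG by blast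
  then obtain z where z: "?H z \<noteq> 0" "\<And>i. i \<in> I \<Longrightarrow> z i \<noteq> 0"
    using polynomial_fun_nonzero_at_hom_coords[OF I polynomial_fun.mult[OF pFG]] by blast
  let ?v = "\<lambda>i\<in>I. proj (z i)"
  have zv: "z \<in> hom_coords I ?v" "?v \<in> cp2_pow I" using z(2) by (auto intro: hom_coords_proj)
  have "?v \<in> nonvanishing_locus I F \<inter> nonvanishing_locus I G"
    using in_nonvanishing_locus_iff[OF I F(1) zv] in_nonvanishing_locus_iff[OF I G(1) zv] z(1) by simp
  hence "U \<inter> W \<noteq> {}" using F(3) G(3) by blast
  thus "w \<in> {}" using W by blast
qed


section \<open>Polynomial relations on the graph of a rational map\<close>

text \<open>Near a point \<open>v\<close> of the maximal domain of definition the map is given by polynomials \<open>P\<close>, and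
  \<open>G x (P x)\<close> is a polynomial in \<open>x\<close>. If it were nonzero at \<open>v\<close>, then it would be nonzero at
  some point near \<open>v\<close> that lies in the domain of \<open>r\<close>, where the relation is known to hold.
  The hypothesis \<open>poly\<close> says that \<open>G\<close> is polynomial in both arguments, in the form in which this is used.\<close>

lemma rat_graph_closed_relation:
  fixes G :: "('i \<Rightarrow> complex^3) \<Rightarrow> ('j \<Rightarrow> complex^3) \<Rightarrow> complex"
  assumes fin: "finite I" "finite J"
    and r: "rational_map I J r" and vy: "(v, y) \<in> rat_graph I J r"
    and poly: "\<And>P. (\<And>j k. polynomial_fun I (P j k)) \<Longrightarrow>
      polynomial_fun I (\<lambda>x. G x (\<lambda>j. \<chi> k. P j k x))"
    and rel: "\<And>u x w. u \<in> fst r \<Longrightarrow> x \<in> hom_coords I u \<Longrightarrow> w \<in> hom_coords J (snd r u) \<Longrightarrow> G x w = 0"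
    and x: "x \<in> hom_coords I v"
  shows "\<exists>w\<in>hom_coords J y. G x w = 0"
proof -
  obtain s where s: "rational_map I J s" "same_rational_map r s" "v \<in> fst s" "y = snd s v"
    using vy unfolding rat_graph_def by auto
  have "\<forall>j\<in>J. \<exists>W P. openin (zariski I) W \<and> v \<in> W \<and> W \<subseteq> fst s \<and> (\<forall>k::3. polynomial_fun I (P k)) \<and>
        (\<forall>u\<in>W. \<forall>x\<in>hom_coords I u. (\<chi> k. P k x) \<noteq> 0 \<and> snd s u j = proj (\<chi> k. P k x))"
  proof
    fix j assume "j \<in> J"
    with s have "\<exists>W e P. openin (zariski I) W \<and> v \<in> W \<and> W \<subseteq> fst s \<and>
        (\<forall>k::3. multihomogeneous I e (P k)) \<and>
        (\<forall>u\<in>W. \<forall>x\<in>hom_coords I u. (\<chi> k. P k x) \<noteq> 0 \<and> snd s u j = proj (\<chi> k. P k x))"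
      unfolding rational_map_def regular_on_def by blast
    then obtain W e P where "openin (zariski I) W" "v \<in> W" "W \<subseteq> fst s"
        "\<forall>k::3. multihomogeneous I e (P k)"
        "\<forall>u\<in>W. \<forall>x\<in>hom_coords I u. (\<chi> k. P k x) \<noteq> 0 \<and> snd s u j = proj (\<chi> k. P k x)"
      by (elim exE conjE)
    thus "\<exists>W P. openin (zariski I) W \<and> v \<in> W \<and> W \<subseteq> fst s \<and> (\<forall>k::3. polynomial_fun I (P k)) \<and>
        (\<forall>u\<in>W. \<forall>x\<in>hom_coords I u. (\<chi> k. P k x) \<noteq> 0 \<and> snd s u j = proj (\<chi> k. P k x))"
      by (intro exI[of _ W] exI[of _ P]) (auto simp: multihomogeneous_def)
  qed
  then obtain W P where WP: "\<And>j. j \<in> J \<Longrightarrow> openin (zariski I) (W j) \<and> v \<in> W j \<and> W j \<subseteq> fst s \<and>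
        (\<forall>k::3. polynomial_fun I (P j k)) \<and>
        (\<forall>u\<in>W j. \<forall>x\<in>hom_coords I u. (\<chi> k. P j k x) \<noteq> 0 \<and> snd s u j = proj (\<chi> k. P j k x))"
    by metis
  \<comment> \<open>\<open>P\<close> is unspecified outside \<open>J\<close>, but \<open>poly\<close> asks for polynomials at every index.\<close>
  define Q where "Q = (\<lambda>j k. if j \<in> J then P j k else (\<lambda>_. 0))"
  define w where "w = (\<lambda>x j. \<chi> k. Q j k x)"
  have w: "w z \<in> hom_coords J (snd s u)"
    if "z \<in> hom_coords I u" "\<And>j. j \<in> J \<Longrightarrow> u \<in> W j" for z u
    unfolding hom_coords_def
  proof safe
    fix j assume j: "j \<in> J"
    have "(\<chi> k. P j k z) \<noteq> 0 \<and> snd s u j = proj (\<chi> k. P j k z)"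
      using WP[OF j] that(1) that(2)[OF j] by blast
    thus "w z j = 0 \<Longrightarrow> False" "proj (w z j) = snd s u j"
      using j by (simp_all add: w_def Q_def)
  qed
  have pG: "polynomial_fun I (\<lambda>x. G x (w x))"
    unfolding w_def by (rule poly) (use WP in \<open>auto simp: Q_def intro: polynomial_fun.const\<close>)
  have "\<forall>j\<in>J. \<exists>F e. multihomogeneous I e F \<and> v \<in> nonvanishing_locus I F \<and> nonvanishing_locus I F \<subseteq> W j"
    using WP zariski_base by (intro ballI) blast
  then obtain F e where F: "\<And>j. j \<in> J \<Longrightarrow> multihomogeneous I (e j) (F j) \<and> v \<in> nonvanishing_locus I (F j) \<and>
      nonvanishing_locus I (F j) \<subseteq> W j" by metis
  have pF: "polynomial_fun I (\<lambda>x. \<Prod>j\<in>J. F j x)"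
    using F fin by (auto intro!: polynomial_fun_prod simp: multihomogeneous_def)
  have nF: "(\<Prod>j\<in>J. F j x) \<noteq> 0"
    using F x fin by (auto simp: nonvanishing_locus_def)
  have "G x (w x) = 0"
  proof (rule ccontr)
    assume "G x (w x) \<noteq> 0"
    define H where "H = (\<lambda>x. (\<Prod>j\<in>J. F j x) * G x (w x))"
    have pH: "polynomial_fun I H" unfolding H_def using pF pG by (rule polynomial_fun.mult)
    have n1: "H x \<noteq> 0" using nF \<open>G x (w x) \<noteq> 0\<close> by (simp add: H_def)
    have op: "openin (zariski I) (fst r)" and "zariski_dense I (fst r)"
      using r by (auto simp: rational_map_def regular_on_def)
    moreover have "openin (zariski I) (fst s)" using s by (auto simp: rational_map_def regular_on_def)
    ultimately have "fst r \<noteq> {}" using s(3) by (auto simp: zariski_dense_iff)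
    then obtain u' where "u' \<in> fst r" by blast
    then obtain D d where D: "multihomogeneous I d D" "u' \<in> nonvanishing_locus I D" "nonvanishing_locus I D \<subseteq> fst r"
      using zariski_base[OF op] by meson
    have pD: "polynomial_fun I D" using D by (simp add: multihomogeneous_def)
    obtain x' where "D x' \<noteq> 0" using nonvanishing_locusD D by blast
    hence "\<exists>z. H z * D z \<noteq> 0" by (rule polynomial_fun_mult_nonzero[OF pH n1 pD])
    then obtain z' where z': "H z' * D z' \<noteq> 0" ..
    have "polynomial_fun I (\<lambda>x. H x * D x)" using pH pD by (rule polynomial_fun.mult)
    from polynomial_fun_nonzero_at_hom_coords[OF fin(1) this z']
    obtain z where "H z * D z \<noteq> 0" and z0: "\<And>i. i \<in> I \<Longrightarrow> z i \<noteq> 0" by blast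
    hence z: "(\<Prod>j\<in>J. F j z) * G z (w z) * D z \<noteq> 0" by (simp add: H_def)
    define u where "u = (\<lambda>i\<in>I. proj (z i))"
    have zu: "z \<in> hom_coords I u" "u \<in> cp2_pow I" using z0 unfolding u_def by (auto intro: hom_coords_proj)
    have "u \<in> nonvanishing_locus I D"
      using in_nonvanishing_locus_iff[OF fin(1) D(1) zu] z by simp
    hence ur: "u \<in> fst r" using D by blast
    have uW: "u \<in> W j" if "j \<in> J" for j
    proof -
      have "F j z \<noteq> 0" using z that fin by auto
      hence "u \<in> nonvanishing_locus I (F j)"
        using in_nonvanishing_locus_iff[OF fin(1) _ zu] F that by blast
      thus ?thesis using F that by blast
    qed
    have "snd r u j = snd s u j" if "j \<in> J" for j
      using s(2) ur uW[OF that] WP[OF that] by (auto simp: same_rational_map_def)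
    hence "w z \<in> hom_coords J (snd r u)" using w[OF zu(1) uW] by (simp add: hom_coords_def)
    hence "G z (w z) = 0" using rel ur zu by blast
    thus False using z by simp
  qed
  moreover have "w x \<in> hom_coords J y" using w[OF x] WP s by blast
  ultimately show ?thesis by blast
qed


section \<open>Triangles inscribed in three lines and circumscribing three points\<close>

text \<open>Cramer's rule: the three determinants are the coordinates of \<open>x\<close> in the basis \<open>p, q, r\<close>, up to the
  common factor \<open>det3 p q r\<close>.\<close>

lemma cramer3:
  "det3 p q r *s x = det3 x q r *s p + det3 p x r *s q + det3 p q x *s r"
  by (simp add: vec3_eq_iff det3_def algebra_simps)

lemma det3_mult_coords:
  "det3 p q r * det3 x y p = det3 p x r * det3 p q y - det3 p q x * det3 p y r"
  "det3 p q r * det3 x y q = det3 p q x * det3 y q r - det3 x q r * det3 p q y"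
  "det3 p q r * det3 x y r = det3 x q r * det3 p y r - det3 p x r * det3 y q r"
  by (simp_all add: det3_def algebra_simps)

lemma det3_combination:
  "det3 (a *s p + b *s q + c *s r) q r = a * det3 p q r"
  "det3 p (a *s p + b *s q + c *s r) r = b * det3 p q r"
  "det3 p q (a *s p + b *s q + c *s r) = c * det3 p q r"
  by (simp_all add: det3_def algebra_simps)

text \<open>The inscribed triangles in coordinates with respect to the basis \<open>p0, p1, p2\<close>. The
  first equation on each vertex puts it on its line, so that up to scaling \<open>A = (s, al2, al3)\<close>,
  \<open>B = (be1, t, be3)\<close> and \<open>C = (ga1, ga2, u)\<close>. The three side conditions become
  \<open>t u = be3 ga2\<close>, \<open>u s = ga1 al3\<close> and \<open>s t = al2 be1\<close>, which determine \<open>s\<^sup>2\<close> and then \<open>t\<close> and \<open>u\<close>.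
  The vertices must first be shown to differ from \<open>p0, p1, p2\<close>, the points at which this scaling
  is impossible.\<close>

lemma triangle_equations:
  fixes al2 al3 be1 be3 ga1 ga2 :: complex
  assumes nz: "al2 \<noteq> 0" "al3 \<noteq> 0" "be1 \<noteq> 0" "be3 \<noteq> 0" "ga1 \<noteq> 0" "ga2 \<noteq> 0"
    and A: "(A1, A2, A3) \<noteq> (0, 0, 0)" "A2 * al3 = A3 * al2"
    and B: "(B1, B2, B3) \<noteq> (0, 0, 0)" "B3 * be1 = B1 * be3"
    and C: "(C1, C2, C3) \<noteq> (0, 0, 0)" "C1 * ga2 = C2 * ga1"
    and BC: "B2 * C3 = B3 * C2" and CA: "C3 * A1 = C1 * A3" and AB: "A1 * B2 = A2 * B1"
  obtains l m n s where "l \<noteq> 0" "m \<noteq> 0" "n \<noteq> 0" "s \<noteq> 0"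
    "s\<^sup>2 * (be3 * ga2) = al2 * al3 * be1 * ga1"
    "A1 = l * s" "A2 = l * al2" "A3 = l * al3"
    "B1 = m * be1" "B2 = m * (al2 * be1 / s)" "B3 = m * be3"
    "C1 = n * ga1" "C2 = n * ga2" "C3 = n * (al3 * ga1 / s)"
proof -
  have iff: "A2 = 0 \<longleftrightarrow> A3 = 0" "B1 = 0 \<longleftrightarrow> B3 = 0" "C1 = 0 \<longleftrightarrow> C2 = 0"
    using A(2) B(2) C(2) nz by auto
  have A2: "A2 \<noteq> 0"
  proof
    assume 0: "A2 = 0"
    hence "C3 = 0" "B2 = 0" using CA AB A(1) iff(1) by auto
    moreover from this have "B3 = 0 \<or> C2 = 0" using BC by auto
    ultimately show False using B(1) C(1) iff by auto
  qed
  have B1: "B1 \<noteq> 0"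
  proof
    assume 0: "B1 = 0"
    hence "C3 = 0" "A1 = 0" using BC AB B(1) iff(2) by auto
    hence "C1 = 0 \<or> A3 = 0" using CA by auto
    thus False using A2 C(1) iff \<open>C3 = 0\<close> by auto
  qed
  have C1: "C1 \<noteq> 0"
  proof
    assume 0: "C1 = 0"
    hence "A1 = 0" using CA C(1) iff(3) by auto
    thus False using AB A2 B1 by auto
  qed
  define l m n s where "l = A2 / al2" and "m = B1 / be1" and "n = C1 / ga1" and "s = A1 / l"
  have l: "l \<noteq> 0" "m \<noteq> 0" "n \<noteq> 0" using A2 B1 C1 nz by (auto simp: l_def m_def n_def)
  have eqs: "A1 = l * s" "A2 = l * al2" "A3 = l * al3" "B1 = m * be1" "B3 = m * be3"
    "C1 = n * ga1" "C2 = n * ga2"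
    using l(1) nz A(2) B(2) C(2) by (simp_all add: s_def l_def m_def n_def field_simps)
  have s: "s \<noteq> 0" using AB A2 B1 eqs by auto
  have B2: "B2 = m * (al2 * be1 / s)" using AB l s unfolding eqs by (simp add: field_simps)
  have C3: "C3 = n * (al3 * ga1 / s)" using CA l s unfolding eqs by (simp add: field_simps)
  have "s\<^sup>2 * (be3 * ga2) = al2 * al3 * be1 * ga1"
    using BC l s unfolding eqs B2 C3 by (simp add: field_simps power2_eq_square)
  thus thesis using that l s eqs B2 C3 by blast
qed

text \<open>Triangles with one vertex on each line \<open>p\<^sub>i q\<^sub>i\<close> and the opposite sides through the points \<open>p\<^sub>i\<close>. With
  collinearity of triples in place of membership in lines the conditions are polynomial, at the price
  of admitting degenerate triangles.\<close>

definition inscribed ::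
  "cp2 \<Rightarrow> cp2 \<Rightarrow> cp2 \<Rightarrow> cp2 \<Rightarrow> cp2 \<Rightarrow> cp2 \<Rightarrow> (cp2 \<times> cp2 \<times> cp2) set" where
  "inscribed p0 p1 p2 q0 q1 q2 = {(A, B, C).
     collinear3 A p0 q0 \<and> collinear3 B p1 q1 \<and> collinear3 C p2 q2 \<and> collinear3 B C p0 \<and> collinear3 C A p1 \<and> collinear3 A B p2}"

text \<open>A quadratic form whose zeros on the line \<open>p0 q0\<close> are, in general position, the first vertices of
  the inscribed triangles. It is the equation for \<open>s\<^sup>2\<close> in \<open>triangle_equations\<close>, which is homogeneous in
  \<open>s, al2, al3\<close>, with the coordinates of \<open>x\<close> in their place.\<close>

definition edge_form :: "complex^3 \<Rightarrow> complex^3 \<Rightarrow> complex^3 \<Rightarrow> complex^3 \<Rightarrow> complex^3 \<Rightarrow> complex^3 \<Rightarrow> complex" where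
  "edge_form p0 p1 p2 q1 q2 x =
     (det3 x p1 p2)\<^sup>2 * (det3 p0 p1 q1 * det3 p0 q2 p2)
     - det3 q1 p1 p2 * det3 q2 p1 p2 * (det3 p0 x p2 * det3 p0 p1 x)"

text \<open>The line \<open>p\<^sub>i q\<^sub>i\<close> depends on \<open>q\<^sub>i\<close> only through two of its coordinates in the basis \<open>p0, p1, p2\<close>. Up to the
  factor \<open>D\<close>, these are \<open>al2, al3\<close> for \<open>q0\<close>, \<open>be1, be3\<close> for \<open>q1\<close> and \<open>ga1, ga2\<close> for \<open>q2\<close>.\<close>

locale six_points =
  fixes p0 p1 p2 q0 q1 q2 :: "complex^3"
  assumes general_position:
    "det3 p0 p1 p2 \<noteq> 0" "det3 p0 q0 p2 \<noteq> 0" "det3 p0 p1 q0 \<noteq> 0" "det3 q1 p1 p2 \<noteq> 0"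
    "det3 p0 p1 q1 \<noteq> 0" "det3 q2 p1 p2 \<noteq> 0" "det3 p0 q2 p2 \<noteq> 0"
begin

definition "D = det3 p0 p1 p2"
definition "al2 = det3 p0 q0 p2"
definition "al3 = det3 p0 p1 q0"
definition "be1 = det3 q1 p1 p2"
definition "be3 = det3 p0 p1 q1"
definition "ga1 = det3 q2 p1 p2"
definition "ga2 = det3 p0 q2 p2"

lemma nz: "D \<noteq> 0" "al2 \<noteq> 0" "al3 \<noteq> 0" "be1 \<noteq> 0" "be3 \<noteq> 0" "ga1 \<noteq> 0" "ga2 \<noteq> 0"
  using general_position
  by (simp_all add: D_def al2_def al3_def be1_def be3_def ga1_def ga2_def)

text \<open>The vertices of the solution with parameter \<open>s\<close>, as given by \<open>triangle_equations\<close>.\<close>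

definition "vA s = s *s p0 + al2 *s p1 + al3 *s p2"
definition "vB s = be1 *s p0 + (al2 * be1 / s) *s p1 + be3 *s p2"
definition "vC s = ga1 *s p0 + ga2 *s p1 + (al3 * ga1 / s) *s p2"

lemma nonzero_coords: "det3 x p1 p2 \<noteq> 0 \<or> det3 p0 x p2 \<noteq> 0 \<or> det3 p0 p1 x \<noteq> 0 \<longleftrightarrow> x \<noteq> 0"
proof -
  have "x = 0" if "det3 x p1 p2 = 0" "det3 p0 x p2 = 0" "det3 p0 p1 x = 0"
    using cramer3[of p0 p1 p2 x] that nz by (simp add: D_def)
  moreover have "det3 0 p1 p2 = 0" "det3 p0 0 p2 = 0" "det3 p0 p1 0 = 0" by (simp_all add: det3_def)
  ultimately show ?thesis by auto
qed

lemma coords: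
  "det3 (vA s) p1 p2 = D * s" "det3 p0 (vA s) p2 = D * al2" "det3 p0 p1 (vA s) = D * al3"
  "det3 (vB s) p1 p2 = D * be1" "det3 p0 (vB s) p2 = D * (al2 * be1 / s)" "det3 p0 p1 (vB s) = D * be3"
  "det3 (vC s) p1 p2 = D * ga1" "det3 p0 (vC s) p2 = D * ga2" "det3 p0 p1 (vC s) = D * (al3 * ga1 / s)"
  by (simp_all add: vA_def vB_def vC_def det3_combination D_def)

lemma nonzero: "vA s \<noteq> 0" "vB s \<noteq> 0" "vC s \<noteq> 0" "p0 \<noteq> 0" "p1 \<noteq> 0" "p2 \<noteq> 0" "q0 \<noteq> 0" "q1 \<noteq> 0" "q2 \<noteq> 0"
proof -
  show "vA s \<noteq> 0" "vB s \<noteq> 0" "vC s \<noteq> 0"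
    using nonzero_coords[of "vA s"] nonzero_coords[of "vB s"] nonzero_coords[of "vC s"] nz coords by auto
  show "p0 \<noteq> 0" "p1 \<noteq> 0" "p2 \<noteq> 0" "q0 \<noteq> 0" "q1 \<noteq> 0" "q2 \<noteq> 0"
    using nz by (auto simp: D_def al2_def be1_def ga1_def det3_def)
qed

lemma det3_0_coords:
  "det3 x y p0 = 0 \<longleftrightarrow> det3 p0 x p2 * det3 p0 p1 y = det3 p0 p1 x * det3 p0 y p2"
  "det3 x y p1 = 0 \<longleftrightarrow> det3 p0 p1 x * det3 y p1 p2 = det3 x p1 p2 * det3 p0 p1 y"
  "det3 x y p2 = 0 \<longleftrightarrow> det3 x p1 p2 * det3 p0 y p2 = det3 p0 x p2 * det3 y p1 p2"
  using det3_mult_coords[of p0 p1 p2 x y] nz by (auto simp: D_def)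

definition "sol s = (proj (vA s), proj (vB s), proj (vC s))"

lemma inscribed_iff:
  assumes "x \<noteq> 0" "y \<noteq> 0" "z \<noteq> 0"
  shows "(proj x, proj y, proj z) \<in> inscribed (proj p0) (proj p1) (proj p2) (proj q0) (proj q1) (proj q2) \<longleftrightarrow>
    det3 p0 x p2 * al3 = det3 p0 p1 x * al2 \<and>
    det3 p0 p1 y * be1 = det3 y p1 p2 * be3 \<and>
    det3 z p1 p2 * ga2 = det3 p0 z p2 * ga1 \<and>
    det3 p0 y p2 * det3 p0 p1 z = det3 p0 p1 y * det3 p0 z p2 \<and>
    det3 p0 p1 z * det3 x p1 p2 = det3 z p1 p2 * det3 p0 p1 x \<and>
    det3 x p1 p2 * det3 p0 y p2 = det3 p0 x p2 * det3 y p1 p2"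
proof -
  have sw: "det3 u v w = 0 \<longleftrightarrow> det3 u w v = 0" for u v w
    by (auto simp: det3_def algebra_simps)
  show ?thesis
    using assms nonzero unfolding inscribed_def
    by (simp add: collinear3_proj_iff sw[of _ p0] sw[of _ p1 q1] sw[of _ p2 q2] det3_0_coords
        al2_def al3_def be1_def be3_def ga1_def ga2_def)
qed

lemma sol_inscribed:
  assumes "s \<noteq> 0" "s\<^sup>2 * (be3 * ga2) = al2 * al3 * be1 * ga1"
  shows "sol s \<in> inscribed (proj p0) (proj p1) (proj p2) (proj q0) (proj q1) (proj q2)"
  unfolding sol_def inscribed_iff[OF nonzero(1-3)] coords
  using assms by (simp add: field_simps power2_eq_square)

lemma inscribed_imp_sol:
  assumes "(A, B, C) \<in> inscribed (proj p0) (proj p1) (proj p2) (proj q0) (proj q1) (proj q2)"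
  shows "\<exists>s. s \<noteq> 0 \<and> s\<^sup>2 * (be3 * ga2) = al2 * al3 * be1 * ga1 \<and> (A, B, C) = sol s"
proof -
  obtain x where x: "x \<noteq> 0" "proj x = A" using ex_proj by blast
  obtain y where y: "y \<noteq> 0" "proj y = B" using ex_proj by blast
  obtain z where z: "z \<noteq> 0" "proj z = C" using ex_proj by blast
  note c = assms[folded x(2) y(2) z(2), unfolded inscribed_iff[OF x(1) y(1) z(1)]]
  have t: "(det3 u p1 p2, det3 p0 u p2, det3 p0 p1 u) \<noteq> (0, 0, 0)" if "u \<noteq> 0" for u
    using nonzero_coords[of u] that by auto
  obtain l m n s where s: "l \<noteq> 0" "m \<noteq> 0" "n \<noteq> 0" "s \<noteq> 0"
    "s\<^sup>2 * (be3 * ga2) = al2 * al3 * be1 * ga1"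
    and e: "det3 x p1 p2 = l * s" "det3 p0 x p2 = l * al2" "det3 p0 p1 x = l * al3"
    "det3 y p1 p2 = m * be1" "det3 p0 y p2 = m * (al2 * be1 / s)" "det3 p0 p1 y = m * be3"
    "det3 z p1 p2 = n * ga1" "det3 p0 z p2 = n * ga2" "det3 p0 p1 z = n * (al3 * ga1 / s)"
    using c by (elim conjE triangle_equations[OF nz(2-) t[OF x(1)] _ t[OF y(1)] _ t[OF z(1)]])
  have "D *s x = l *s vA s" "D *s y = m *s vB s" "D *s z = n *s vC s"
    using cramer3[of p0 p1 p2 x] cramer3[of p0 p1 p2 y] cramer3[of p0 p1 p2 z]
    unfolding e D_def vA_def vB_def vC_def by (simp_all add: vector_add_ldistrib vector_smult_assoc)
  hence "proj x = proj (vA s)" "proj y = proj (vB s)" "proj z = proj (vC s)"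
    using proj_scale nz(1) s(1-3) x(1) y(1) z(1) nonzero(1-3) by metis+
  thus ?thesis using s x y z by (auto simp: sol_def)
qed

lemma proj_vA_inj:
  assumes "proj (vA s) = proj (vA t)"
  shows "s = t"
proof -
  obtain c where e: "vA t = c *s vA s" using proj_eqD[OF assms nonzero(1) nonzero(1)] by blast
  have "D * t = c * (D * s)" "D * al2 = c * (D * al2)"
    using coords(1,2)[of t, unfolded e det3_scale coords] by (auto simp del: mult_cancel_left)
  thus ?thesis using nz by simp
qed

text \<open>The two triangles belong to the two square roots of the prescribed value of \<open>s\<^sup>2\<close>.\<close>

lemma card_inscribed:
  "finite (inscribed (proj p0) (proj p1) (proj p2) (proj q0) (proj q1) (proj q2))"
  "card (inscribed (proj p0) (proj p1) (proj p2) (proj q0) (proj q1) (proj q2)) = 2"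
proof -
  let ?I = "inscribed (proj p0) (proj p1) (proj p2) (proj q0) (proj q1) (proj q2)"
  define r where "r = csqrt (al2 * al3 * be1 * ga1 / (be3 * ga2))"
  have r2: "r\<^sup>2 * (be3 * ga2) = al2 * al3 * be1 * ga1" using nz by (simp add: r_def)
  hence r0: "r \<noteq> 0" using nz by auto
  have "s = r \<or> s = - r" if "s\<^sup>2 * (be3 * ga2) = al2 * al3 * be1 * ga1" for s
  proof -
    have "s\<^sup>2 * (be3 * ga2) = r\<^sup>2 * (be3 * ga2)" using that r2 by simp
    hence "s\<^sup>2 = r\<^sup>2" using nz by simp
    thus ?thesis by (simp add: power2_eq_iff)
  qed
  hence "?I \<subseteq> {sol r, sol (- r)}" using inscribed_imp_sol by fastforce
  moreover have "{sol r, sol (- r)} \<subseteq> ?I" using sol_inscribed r0 r2 by simp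
  ultimately have "?I = {sol r, sol (- r)}" by (rule subset_antisym)
  moreover have "sol r \<noteq> sol (- r)"
  proof
    assume "sol r = sol (- r)"
    hence "r = - r" by (intro proj_vA_inj) (simp add: sol_def)
    thus False using r0 by simp
  qed
  ultimately show "finite ?I" "card ?I = 2" by simp_all
qed

text \<open>Put \<open>X = al2 be3 ga1\<close> and \<open>Y = al3 be1 ga2\<close>. The determinant of the three vertices equals
  \<open>X + Y - 2 s t u\<close> up to a nonzero factor, and \<open>(s t u)\<^sup>2 = X Y\<close>. So it can vanish only if \<open>(X - Y)\<^sup>2 = 0\<close>,
  that is, if the three lines are concurrent by Ceva's theorem.\<close>

lemma inscribed_not_collinear3:
  assumes "(A, B, C) \<in> inscribed (proj p0) (proj p1) (proj p2) (proj q0) (proj q1) (proj q2)"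
    and ne: "al2 * be3 * ga1 \<noteq> al3 * be1 * ga2"
  shows "\<not> collinear3 A B C"
proof
  assume c: "collinear3 A B C"
  obtain s where s: "s \<noteq> 0" "s\<^sup>2 * (be3 * ga2) = al2 * al3 * be1 * ga1" "(A, B, C) = sol s"
    using inscribed_imp_sol[OF assms(1)] by blast
  have "det3 (vA s) (vB s) (vC s) = 0"
    using c s(3) nonzero by (simp add: sol_def collinear3_proj_iff)
  moreover have "det3 (a1 *s p0 + a2 *s p1 + a3 *s p2) (b1 *s p0 + b2 *s p1 + b3 *s p2)
      (c1 *s p0 + c2 *s p1 + c3 *s p2) = D * (a1 * (b2 * c3 - b3 * c2) - a2 * (b1 * c3 - b3 * c1) + a3 * (b1 * c2 - b2 * c1))"
    for a1 a2 a3 b1 b2 b3 c1 c2 c3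
    by (simp add: D_def det3_def algebra_simps)
  ultimately have z: "s * (al2 * be1 / s * (al3 * ga1 / s) - be3 * ga2) - al2 * (be1 * (al3 * ga1 / s) - be3 * ga1)
     + al3 * (be1 * ga2 - al2 * be1 / s * ga1) = 0"
    using nz unfolding vA_def vB_def vC_def by (metis mult_eq_0_iff)
  have e: "al2 * be1 / s * (al3 * ga1 / s) = be3 * ga2"
    using s by (simp add: field_simps power2_eq_square)
  have "al2 * be3 * ga1 + al3 * be1 * ga2 = 2 * (al2 * al3 * be1 * ga1 / s)"
    using z unfolding e by (simp add: algebra_simps)
  hence "(al2 * be3 * ga1 + al3 * be1 * ga2)\<^sup>2 = 4 * ((al2 * al3 * be1 * ga1)\<^sup>2 / s\<^sup>2)"
    by (simp add: power_mult_distrib power_divide)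
  also have "(al2 * al3 * be1 * ga1)\<^sup>2 / s\<^sup>2 = al2 * al3 * be1 * ga1 * (be3 * ga2)"
    unfolding s(2)[symmetric] using s(1) by (simp add: power2_eq_square)
  finally have "(al2 * be3 * ga1 - al3 * be1 * ga2)\<^sup>2 = 0"
    by (simp add: power2_eq_square algebra_simps)
  thus False using ne by simp
qed

lemma inscribed_edge_form:
  assumes "(A, B, C) \<in> inscribed (proj p0) (proj p1) (proj p2) (proj q0) (proj q1) (proj q2)"
    and x: "x \<noteq> 0" "proj x = A"
  shows "edge_form p0 p1 p2 q1 q2 x = 0"
proof -
  obtain s where s: "s \<noteq> 0" "s\<^sup>2 * (be3 * ga2) = al2 * al3 * be1 * ga1" "(A, B, C) = sol s"
    using inscribed_imp_sol[OF assms(1)] by blast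
  have "proj (vA s) = proj x" using s x by (simp add: sol_def)
  then obtain c where c: "x = c *s vA s" using proj_eqD[OF _ nonzero(1) x(1)] by blast
  have "edge_form p0 p1 p2 q1 q2 x
      = (c * D)\<^sup>2 * (s\<^sup>2 * (be3 * ga2) - al2 * al3 * be1 * ga1)"
    unfolding edge_form_def c det3_scale coords be1_def be3_def ga1_def ga2_def
    by (simp add: power2_eq_square algebra_simps)
  thus ?thesis using s by simp
qed

end

text \<open>The Sylvester resultant of two binary quadratic forms vanishes if they have a common zero. It is
  written as an equation between its two terms.\<close>

lemma common_root_resultant:
  fixes a b c a' b' c' l m :: complex
  assumes "a * l\<^sup>2 + b * l * m + c * m\<^sup>2 = 0" "a' * l\<^sup>2 + b' * l * m + c' * m\<^sup>2 = 0"
    and "l \<noteq> 0 \<or> m \<noteq> 0"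
  shows "(a * c' - a' * c)\<^sup>2 = (a * b' - a' * b) * (b * c' - b' * c)"
proof -
  have 1: "m * ((b * a' - b' * a) * l + (c * a' - c' * a) * m) = 0"
    using assms(1,2) by algebra
  have 2: "l * ((a * c' - a' * c) * l + (b * c' - b' * c) * m) = 0"
    using assms(1,2) by algebra
  consider "l = 0" "m \<noteq> 0" | "l \<noteq> 0" "m = 0" | "l \<noteq> 0" "m \<noteq> 0" using assms(3) by blast
  thus ?thesis
  proof cases
    case 1 with assms show ?thesis by simp
  next
    case 2 with assms show ?thesis by simp
  next
    case 3
    with 1 2 have e: "(b * a' - b' * a) * l + (c * a' - c' * a) * m = 0"
      "(a * c' - a' * c) * l + (b * c' - b' * c) * m = 0" by simp_all
    have "((a * c' - a' * c)\<^sup>2 - (a * b' - a' * b) * (b * c' - b' * c)) * l = 0"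
      using e by algebra
    thus ?thesis using 3 by simp
  qed
qed


section \<open>Six points in general position\<close>

text \<open>The coefficients of \<open>edge_form\<close> on the line \<open>p0 q0\<close>, with respect to the basis \<open>p0, q0\<close>.\<close>

definition edge_coeff0 :: "complex^3 \<Rightarrow> complex^3 \<Rightarrow> complex^3 \<Rightarrow> complex^3 \<Rightarrow> complex^3 \<Rightarrow> complex^3 \<Rightarrow> complex" where
  "edge_coeff0 p0 p1 p2 q0 q1 q2 = (det3 p0 p1 p2)\<^sup>2 * (det3 p0 p1 q1 * det3 p0 q2 p2)"

definition edge_coeff1 :: "complex^3 \<Rightarrow> complex^3 \<Rightarrow> complex^3 \<Rightarrow> complex^3 \<Rightarrow> complex^3 \<Rightarrow> complex^3 \<Rightarrow> complex" where
  "edge_coeff1 p0 p1 p2 q0 q1 q2 =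
     2 * det3 p0 p1 p2 * det3 q0 p1 p2 * (det3 p0 p1 q1 * det3 p0 q2 p2)"

definition edge_coeff2 :: "complex^3 \<Rightarrow> complex^3 \<Rightarrow> complex^3 \<Rightarrow> complex^3 \<Rightarrow> complex^3 \<Rightarrow> complex^3 \<Rightarrow> complex" where
  "edge_coeff2 p0 p1 p2 q0 q1 q2 = (det3 q0 p1 p2)\<^sup>2 * (det3 p0 p1 q1 * det3 p0 q2 p2)
     - det3 q1 p1 p2 * det3 q2 p1 p2 * (det3 p0 q0 p2 * det3 p0 p1 q0)"

lemma edge_form_on_line:
  "edge_form p0 p1 p2 q1 q2 (l *s p0 + m *s q0) =
     edge_coeff0 p0 p1 p2 q0 q1 q2 * l\<^sup>2 + edge_coeff1 p0 p1 p2 q0 q1 q2 * l * m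
     + edge_coeff2 p0 p1 p2 q0 q1 q2 * m\<^sup>2"
proof -
  have "det3 (l *s p0 + m *s q0) p1 p2 = l * det3 p0 p1 p2 + m * det3 q0 p1 p2"
    "det3 p0 (l *s p0 + m *s q0) p2 = m * det3 p0 q0 p2"
    "det3 p0 p1 (l *s p0 + m *s q0) = m * det3 p0 p1 q0"
    by (simp_all add: det3_def algebra_simps)
  thus ?thesis
    unfolding edge_form_def edge_coeff0_def edge_coeff1_def edge_coeff2_def
    by (simp add: power2_eq_square algebra_simps)
qed

text \<open>The two triangles that share the line \<open>p0 q0\<close> are obtained from each other by interchanging \<open>p\<close> and \<open>q\<close>.
  This is the resultant of their forms; in the common basis \<open>p0, q0\<close> the coefficients of the
  second form appear in reverse order.\<close>

definition edge_resultant :: "complex^3 \<Rightarrow> complex^3 \<Rightarrow> complex^3 \<Rightarrow> complex^3 \<Rightarrow> complex^3 \<Rightarrow> complex^3 \<Rightarrow> complex" where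
  "edge_resultant p0 p1 p2 q0 q1 q2 =
    (edge_coeff0 p0 p1 p2 q0 q1 q2 * edge_coeff0 q0 q1 q2 p0 p1 p2
      - edge_coeff2 q0 q1 q2 p0 p1 p2 * edge_coeff2 p0 p1 p2 q0 q1 q2)\<^sup>2
    - (edge_coeff0 p0 p1 p2 q0 q1 q2 * edge_coeff1 q0 q1 q2 p0 p1 p2
        - edge_coeff2 q0 q1 q2 p0 p1 p2 * edge_coeff1 p0 p1 p2 q0 q1 q2)
      * (edge_coeff1 p0 p1 p2 q0 q1 q2 * edge_coeff0 q0 q1 q2 p0 p1 p2
        - edge_coeff1 q0 q1 q2 p0 p1 p2 * edge_coeff2 p0 p1 p2 q0 q1 q2)"

text \<open>The first seven factors ensure general position, the difference excludes concurrent lines and hence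
  degenerate triangles, and the resultant keeps the two triangles apart.\<close>

definition genericity :: "complex^3 \<Rightarrow> complex^3 \<Rightarrow> complex^3 \<Rightarrow> complex^3 \<Rightarrow> complex^3 \<Rightarrow> complex^3 \<Rightarrow> complex" where
  "genericity p0 p1 p2 q0 q1 q2 =
     det3 p0 p1 p2 * det3 p0 q0 p2 * det3 p0 p1 q0 * det3 q1 p1 p2 * det3 p0 p1 q1
       * det3 q2 p1 p2 * det3 p0 q2 p2
     * (det3 p0 q0 p2 * det3 p0 p1 q1 * det3 q2 p1 p2
        - det3 p0 p1 q0 * det3 q1 p1 p2 * det3 p0 q2 p2)
     * edge_resultant p0 p1 p2 q0 q1 q2"

lemma edge_coeff_scale:
  "edge_coeff0 (c *s p0) p1 p2 q0 q1 q2 = c^4 * edge_coeff0 p0 p1 p2 q0 q1 q2"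
  "edge_coeff0 p0 (c *s p1) p2 q0 q1 q2 = c^3 * edge_coeff0 p0 p1 p2 q0 q1 q2"
  "edge_coeff0 p0 p1 (c *s p2) q0 q1 q2 = c^3 * edge_coeff0 p0 p1 p2 q0 q1 q2"
  "edge_coeff0 p0 p1 p2 (c *s q0) q1 q2 = edge_coeff0 p0 p1 p2 q0 q1 q2"
  "edge_coeff0 p0 p1 p2 q0 (c *s q1) q2 = c * edge_coeff0 p0 p1 p2 q0 q1 q2"
  "edge_coeff0 p0 p1 p2 q0 q1 (c *s q2) = c * edge_coeff0 p0 p1 p2 q0 q1 q2"
  "edge_coeff1 (c *s p0) p1 p2 q0 q1 q2 = c^3 * edge_coeff1 p0 p1 p2 q0 q1 q2"
  "edge_coeff1 p0 (c *s p1) p2 q0 q1 q2 = c^3 * edge_coeff1 p0 p1 p2 q0 q1 q2"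
  "edge_coeff1 p0 p1 (c *s p2) q0 q1 q2 = c^3 * edge_coeff1 p0 p1 p2 q0 q1 q2"
  "edge_coeff1 p0 p1 p2 (c *s q0) q1 q2 = c * edge_coeff1 p0 p1 p2 q0 q1 q2"
  "edge_coeff1 p0 p1 p2 q0 (c *s q1) q2 = c * edge_coeff1 p0 p1 p2 q0 q1 q2"
  "edge_coeff1 p0 p1 p2 q0 q1 (c *s q2) = c * edge_coeff1 p0 p1 p2 q0 q1 q2"
  "edge_coeff2 (c *s p0) p1 p2 q0 q1 q2 = c^2 * edge_coeff2 p0 p1 p2 q0 q1 q2"
  "edge_coeff2 p0 (c *s p1) p2 q0 q1 q2 = c^3 * edge_coeff2 p0 p1 p2 q0 q1 q2"
  "edge_coeff2 p0 p1 (c *s p2) q0 q1 q2 = c^3 * edge_coeff2 p0 p1 p2 q0 q1 q2"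
  "edge_coeff2 p0 p1 p2 (c *s q0) q1 q2 = c^2 * edge_coeff2 p0 p1 p2 q0 q1 q2"
  "edge_coeff2 p0 p1 p2 q0 (c *s q1) q2 = c * edge_coeff2 p0 p1 p2 q0 q1 q2"
  "edge_coeff2 p0 p1 p2 q0 q1 (c *s q2) = c * edge_coeff2 p0 p1 p2 q0 q1 q2"
  unfolding edge_coeff0_def edge_coeff1_def edge_coeff2_def det3_scale
  by (simp_all add: power2_eq_square power3_eq_cube power4_eq_xxxx algebra_simps)

lemma edge_resultant_scale:
  "edge_resultant (c *s p0) p1 p2 q0 q1 q2 = c^8 * edge_resultant p0 p1 p2 q0 q1 q2"
  "edge_resultant p0 (c *s p1) p2 q0 q1 q2 = c^8 * edge_resultant p0 p1 p2 q0 q1 q2"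
  "edge_resultant p0 p1 (c *s p2) q0 q1 q2 = c^8 * edge_resultant p0 p1 p2 q0 q1 q2"
  "edge_resultant p0 p1 p2 (c *s q0) q1 q2 = c^8 * edge_resultant p0 p1 p2 q0 q1 q2"
  "edge_resultant p0 p1 p2 q0 (c *s q1) q2 = c^8 * edge_resultant p0 p1 p2 q0 q1 q2"
  "edge_resultant p0 p1 p2 q0 q1 (c *s q2) = c^8 * edge_resultant p0 p1 p2 q0 q1 q2"
  unfolding edge_resultant_def edge_coeff_scale
  by (simp_all add: power2_eq_square algebra_simps eval_nat_numeral)

lemma genericity_scale:
  "genericity (c *s p0) p1 p2 q0 q1 q2 = c^15 * genericity p0 p1 p2 q0 q1 q2"
  "genericity p0 (c *s p1) p2 q0 q1 q2 = c^15 * genericity p0 p1 p2 q0 q1 q2"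
  "genericity p0 p1 (c *s p2) q0 q1 q2 = c^15 * genericity p0 p1 p2 q0 q1 q2"
  "genericity p0 p1 p2 (c *s q0) q1 q2 = c^11 * genericity p0 p1 p2 q0 q1 q2"
  "genericity p0 p1 p2 q0 (c *s q1) q2 = c^11 * genericity p0 p1 p2 q0 q1 q2"
  "genericity p0 p1 p2 q0 q1 (c *s q2) = c^11 * genericity p0 p1 p2 q0 q1 q2"
  unfolding genericity_def edge_resultant_scale det3_scale
  by (simp_all add: algebra_simps eval_nat_numeral)

lemma genericity_example:
  "genericity (vector [1, 0, 0]) (vector [0, 1, 0]) (vector [0, 0, 1])
     (vector [1, 1, 1]) (vector [-1, 0, 1]) (vector [1, 1, 0]) \<noteq> 0"
  by (simp add: genericity_def edge_resultant_def edge_coeff0_def edge_coeff1_def edge_coeff2_def det3_def)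

lemma six_points_if_generic:
  assumes "genericity p0 p1 p2 q0 q1 q2 \<noteq> 0"
  shows "six_points p0 p1 p2 q0 q1 q2"
  using assms by unfold_locales (simp_all add: genericity_def)

text \<open>A common first vertex would be a common zero of the two quadratic forms on the line \<open>p0 q0\<close>.\<close>

lemma inscribed_disjoint:
  assumes g: "genericity p0 p1 p2 q0 q1 q2 \<noteq> 0" "genericity q0 q1 q2 p0 p1 p2 \<noteq> 0"
    and P: "(A, B, C) \<in> inscribed (proj p0) (proj p1) (proj p2) (proj q0) (proj q1) (proj q2)"
    and Q: "(A', B', C') \<in> inscribed (proj q0) (proj q1) (proj q2) (proj p0) (proj p1) (proj p2)"
  shows "A \<noteq> A'"
proof
  assume "A = A'"
  interpret P: six_points p0 p1 p2 q0 q1 q2 by (rule six_points_if_generic) fact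
  interpret Q: six_points q0 q1 q2 p0 p1 p2 by (rule six_points_if_generic) fact
  obtain x where x: "x \<noteq> 0" "proj x = A" using ex_proj by blast
  have "collinear3 (proj p0) (proj q0) (proj x)"
    using P x(2) collinear3_swap unfolding inscribed_def by blast
  hence "det3 p0 q0 x = 0" using P.nonzero x(1) by (simp add: collinear3_proj_iff)
  moreover have "ccross p0 q0 \<noteq> 0"
  proof
    assume "ccross p0 q0 = 0"
    moreover have "det3 p0 q0 p2 = ccross p0 q0 $ 1 * p2 $ 1 + ccross p0 q0 $ 2 * p2 $ 2 + ccross p0 q0 $ 3 * p2 $ 3"
      by (simp add: det3_def algebra_simps)
    ultimately show False using P.general_position by simp
  qed
  ultimately obtain l m where lm: "x = l *s p0 + m *s q0"
    using det3_eq_0_imp_combination by blast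
  have "edge_coeff0 p0 p1 p2 q0 q1 q2 * l\<^sup>2 + edge_coeff1 p0 p1 p2 q0 q1 q2 * l * m
     + edge_coeff2 p0 p1 p2 q0 q1 q2 * m\<^sup>2 = 0"
    using P.inscribed_edge_form[OF P x] by (simp add: lm edge_form_on_line)
  moreover have "edge_coeff2 q0 q1 q2 p0 p1 p2 * l\<^sup>2 + edge_coeff1 q0 q1 q2 p0 p1 p2 * l * m
     + edge_coeff0 q0 q1 q2 p0 p1 p2 * m\<^sup>2 = 0"
  proof -
    have "x = m *s q0 + l *s p0" by (simp add: lm)
    hence "edge_form q0 q1 q2 p1 p2 (m *s q0 + l *s p0) = 0"
      using Q.inscribed_edge_form[OF Q x(1)] x(2) \<open>A = A'\<close> by simp
    thus ?thesis unfolding edge_form_on_line by (simp add: algebra_simps)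
  qed
  moreover have "l \<noteq> 0 \<or> m \<noteq> 0" using lm x(1) by auto
  ultimately have "edge_resultant p0 p1 p2 q0 q1 q2 = 0"
    unfolding edge_resultant_def right_minus_eq by (rule common_root_resultant)
  thus False using g(1) by (simp add: genericity_def)
qed

lemma polynomial_fun_det3:
  assumes "\<And>k. polynomial_fun I (\<lambda>x. X x $ k)" "\<And>k. polynomial_fun I (\<lambda>x. Y x $ k)"
    "\<And>k. polynomial_fun I (\<lambda>x. Z x $ k)"
  shows "polynomial_fun I (\<lambda>x. det3 (X x) (Y x) (Z x))"
  unfolding det3_def by (intro polynomial_fun_intros assms)

lemma polynomial_fun_genericity:
  assumes "{i0, i1, i2, i3, i4, i5} \<subseteq> I"
  shows "polynomial_fun I (\<lambda>x. genericity (x i0) (x i1) (x i2) (x i3) (x i4) (x i5))"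
  unfolding genericity_def edge_resultant_def edge_coeff0_def edge_coeff1_def edge_coeff2_def
  by (intro polynomial_fun_intros polynomial_fun_det3) (use assms in auto)

lemma multihomogeneous_genericity:
  assumes "{i0, i1, i2, i3, i4, i5} \<subseteq> I" "distinct [i0, i1, i2, i3, i4, i5]"
  shows "multihomogeneous I (\<lambda>j. if j \<in> {i0, i1, i2} then 15 else if j \<in> {i3, i4, i5} then 11 else 0)
     (\<lambda>x. genericity (x i0) (x i1) (x i2) (x i3) (x i4) (x i5))"
  unfolding multihomogeneous_def
proof (intro conjI allI ballI)
  show "polynomial_fun I (\<lambda>x. genericity (x i0) (x i1) (x i2) (x i3) (x i4) (x i5))"
    by (rule polynomial_fun_genericity) fact
  fix x :: "'a \<Rightarrow> complex^3" and c j
  consider "j = i0" | "j = i1" | "j = i2" | "j = i3" | "j = i4" | "j = i5"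
    | "j \<notin> {i0, i1, i2, i3, i4, i5}" by blast
  thus "genericity ((x(j := c *s x j)) i0) ((x(j := c *s x j)) i1) ((x(j := c *s x j)) i2)
      ((x(j := c *s x j)) i3) ((x(j := c *s x j)) i4) ((x(j := c *s x j)) i5) =
    c ^ (if j \<in> {i0, i1, i2} then 15 else if j \<in> {i3, i4, i5} then 11 else 0)
      * genericity (x i0) (x i1) (x i2) (x i3) (x i4) (x i5)"
    by cases (use assms(2) in \<open>auto simp: genericity_scale\<close>)
qed


section \<open>Skew pentagram maps as rational maps\<close>

text \<open>Homogeneous coordinates of the image vertex \<open>i\<close> as polynomials in those of the polygon.\<close>

definition meet_vec :: "nat \<Rightarrow> int \<Rightarrow> int \<Rightarrow> int \<Rightarrow> int \<Rightarrow> (int \<Rightarrow> complex^3) \<Rightarrow> int \<Rightarrow> complex^3" where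
  "meet_vec n a b c d x i =
     ccross (ccross (x ((i + a) mod int n)) (x ((i + b) mod int n)))
       (ccross (x ((i + c) mod int n)) (x ((i + d) mod int n)))"

lemma polynomial_fun_ccross:
  assumes "\<And>k. polynomial_fun I (\<lambda>x. X x $ k)" "\<And>k. polynomial_fun I (\<lambda>x. Y x $ k)"
  shows "polynomial_fun I (\<lambda>x. ccross (X x) (Y x) $ k)"
proof -
  consider "k = 1" | "k = 2" | "k = 3" using exhaust_3 by blast
  thus ?thesis by cases (simp_all add: polynomial_fun_intros assms)
qed

lemma multihomogeneous_meet_vec:
  assumes n: "n > 0" and dist: "distinct [a mod int n, b mod int n, c mod int n, d mod int n]"
  shows "multihomogeneous (idx n)
     (\<lambda>j. if j \<in> {(i + a) mod int n, (i + b) mod int n, (i + c) mod int n, (i + d) mod int n} then 1 else 0)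
     (\<lambda>x. meet_vec n a b c d x i $ k)"
  unfolding multihomogeneous_def
proof (intro conjI allI ballI)
  have m: "j mod int n \<in> idx n" for j using n by simp
  show "polynomial_fun (idx n) (\<lambda>x. meet_vec n a b c d x i $ k)"
    unfolding meet_vec_def by (intro polynomial_fun_ccross polynomial_fun.coord m)
  have "(i + p) mod int n \<noteq> (i + q) mod int n" if "p mod int n \<noteq> q mod int n" for p q
    using that by (metis add_diff_cancel_left mod_eq_dvd_iff)
  hence d: "distinct [(i + a) mod int n, (i + b) mod int n, (i + c) mod int n, (i + d) mod int n]"
    using dist by simp
  fix x :: "int \<Rightarrow> complex^3" and s j
  consider "j = (i + a) mod int n" | "j = (i + b) mod int n" | "j = (i + c) mod int n"
    | "j = (i + d) mod int n"
    | "j \<notin> {(i + a) mod int n, (i + b) mod int n, (i + c) mod int n, (i + d) mod int n}" by blast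
  thus "meet_vec n a b c d (x(j := s *s x j)) i $ k =
    s ^ (if j \<in> {(i + a) mod int n, (i + b) mod int n, (i + c) mod int n, (i + d) mod int n} then 1 else 0)
      * meet_vec n a b c d x i $ k"
    unfolding meet_vec_def
    by cases (use d in \<open>auto simp: ccross_scale\<close>)
qed

lemma vertex_hom_coords:
  assumes "n > 0" "x \<in> hom_coords (idx n) v"
  shows "x (j mod int n) \<noteq> 0" "proj (x (j mod int n)) = vertex n v j"
  using assms by (auto simp: hom_coords_def vertex_def)

lemma skew_pentagram_dom_iff:
  assumes n: "n > 0" and v: "v \<in> cp2_pow (idx n)" and x: "x \<in> hom_coords (idx n) v"
  shows "v \<in> skew_pentagram_dom n a b c d \<longleftrightarrow> (\<forall>i\<in>idx n. meet_vec n a b c d x i \<noteq> 0)"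
  unfolding skew_pentagram_dom_def meet_vec_def
  using v lines_meet(1)[OF vertex_hom_coords(1)[OF n x] vertex_hom_coords(1)[OF n x]
      vertex_hom_coords(1)[OF n x] vertex_hom_coords(1)[OF n x]]
  by (simp add: vertex_hom_coords(2)[OF n x])

lemma skew_pentagram_lines_meet:
  assumes n: "n > 0" and v: "v \<in> skew_pentagram_dom n a b c d" and x: "x \<in> hom_coords (idx n) v"
    and i: "i \<in> idx n"
  shows "proj_line (vertex n v (i + a)) (vertex n v (i + b)) \<inter>
           proj_line (vertex n v (i + c)) (vertex n v (i + d)) = {proj (meet_vec n a b c d x i)}"
    and "snd (skew_pentagram_map n a b c d) v i = proj (meet_vec n a b c d x i)"
proof -
  have "v \<in> cp2_pow (idx n)" using v by (simp add: skew_pentagram_dom_def)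
  hence "meet_vec n a b c d x i \<noteq> 0" using skew_pentagram_dom_iff n v x i by blast
  thus *: "proj_line (vertex n v (i + a)) (vertex n v (i + b)) \<inter>
           proj_line (vertex n v (i + c)) (vertex n v (i + d)) = {proj (meet_vec n a b c d x i)}"
    unfolding meet_vec_def vertex_hom_coords(2)[OF n x, symmetric]
    by (intro lines_meet(2) vertex_hom_coords(1)[OF n x])
  show "snd (skew_pentagram_map n a b c d) v i = proj (meet_vec n a b c d x i)"
    using i * by (simp add: skew_pentagram_map_def)
qed

lemma skew_pentagram_image:
  assumes n: "n > 0" and v: "v \<in> skew_pentagram_dom n a b c d"
  defines "w \<equiv> snd (skew_pentagram_map n a b c d) v"
  shows "vertex n v (j + a) \<noteq> vertex n v (j + b)" "vertex n v (j + c) \<noteq> vertex n v (j + d)"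
    and "collinear3 (vertex n v (j + a)) (vertex n v (j + b)) (vertex n w j)"
    and "collinear3 (vertex n v (j + c)) (vertex n v (j + d)) (vertex n w j)"
proof -
  obtain x where x: "x \<in> hom_coords (idx n) v" using hom_coords_nonempty by blast
  let ?i = "j mod int n"
  have i: "?i \<in> idx n" using n by simp
  have e: "vertex n v (?i + p) = vertex n v (j + p)" for p by (simp add: vertex_def mod_simps)
  have d: "vertex n v (?i + a) \<noteq> vertex n v (?i + b)" "vertex n v (?i + c) \<noteq> vertex n v (?i + d)"
    using v i unfolding skew_pentagram_dom_def by blast+
  thus "vertex n v (j + a) \<noteq> vertex n v (j + b)" "vertex n v (j + c) \<noteq> vertex n v (j + d)"
    unfolding e .
  have "vertex n w j \<in> proj_line (vertex n v (?i + a)) (vertex n v (?i + b)) \<inter>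
           proj_line (vertex n v (?i + c)) (vertex n v (?i + d))"
    using skew_pentagram_lines_meet[OF n v x i] by (simp add: w_def vertex_def)
  thus "collinear3 (vertex n v (j + a)) (vertex n v (j + b)) (vertex n w j)"
    "collinear3 (vertex n v (j + c)) (vertex n v (j + d)) (vertex n w j)"
    using d in_proj_line_iff_collinear3 unfolding e by blast+
qed

lemma openin_skew_pentagram_dom:
  assumes n: "n > 0" and dist: "distinct [a mod int n, b mod int n, c mod int n, d mod int n]"
  shows "openin (zariski (idx n)) (skew_pentagram_dom n a b c d)"
proof -
  let ?N = "\<lambda>i k. nonvanishing_locus (idx n) (\<lambda>x. meet_vec n a b c d x i $ k)"
  note mh = multihomogeneous_meet_vec[OF n dist]
  have "v \<in> skew_pentagram_dom n a b c d \<longleftrightarrow> v \<in> (\<Inter>i\<in>idx n. \<Union>k. ?N i k)" for v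
  proof (cases "v \<in> cp2_pow (idx n)")
    case True
    obtain x where x: "x \<in> hom_coords (idx n) v" using hom_coords_nonempty by blast
    have "v \<in> ?N i k \<longleftrightarrow> meet_vec n a b c d x i $ k \<noteq> 0" for i k
      by (rule in_nonvanishing_locus_iff[OF _ mh x True]) simp
    thus ?thesis using skew_pentagram_dom_iff[OF n True x, of a b c d] by (simp add: vec_eq_iff)
  next
    case False
    moreover have "0 \<in> idx n" using n by simp
    ultimately show ?thesis by (auto simp: skew_pentagram_dom_def nonvanishing_locus_def)
  qed
  hence "skew_pentagram_dom n a b c d = (\<Inter>i\<in>idx n. \<Union>k. ?N i k)" by blast
  moreover have "openin (zariski (idx n)) (\<Inter>i\<in>idx n. \<Union>k. ?N i k)"
  proof (intro openin_Inter)
    show "(\<lambda>i. \<Union>k. ?N i k) ` idx n \<noteq> {}" using n by simp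
    fix X assume "X \<in> (\<lambda>i. \<Union>k. ?N i k) ` idx n"
    then obtain i where "X = (\<Union>k. ?N i k)" by blast
    thus "openin (zariski (idx n)) X" using openin_nonvanishing_locus[OF mh] by blast
  qed simp
  ultimately show ?thesis by simp
qed

lemma regular_on_skew_pentagram_map:
  assumes n: "n > 0" and dist: "distinct [a mod int n, b mod int n, c mod int n, d mod int n]"
  shows "regular_on (idx n) (idx n) (skew_pentagram_dom n a b c d) (snd (skew_pentagram_map n a b c d))"
  unfolding regular_on_def
proof (intro conjI ballI)
  let ?D = "skew_pentagram_dom n a b c d" and ?f = "snd (skew_pentagram_map n a b c d)"
  show op: "openin (zariski (idx n)) ?D" by (rule openin_skew_pentagram_dom[OF assms])
  show "?f ` ?D \<subseteq> cp2_pow (idx n)" by (auto simp: skew_pentagram_map_def)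
  fix v j assume v: "v \<in> ?D" and j: "j \<in> idx n"
  let ?P = "\<lambda>k x. meet_vec n a b c d x j $ k"
  have "(\<chi> k. ?P k x) \<noteq> 0 \<and> ?f u j = proj (\<chi> k. ?P k x)"
    if u: "u \<in> ?D" and x: "x \<in> hom_coords (idx n) u" for u x
  proof -
    have "u \<in> cp2_pow (idx n)" using u by (simp add: skew_pentagram_dom_def)
    thus ?thesis
      using skew_pentagram_dom_iff[OF n _ x, of a b c d] skew_pentagram_lines_meet(2)[OF n u x j] u j
      by (simp add: vec_lambda_eta)
  qed
  thus "\<exists>W e P. openin (zariski (idx n)) W \<and> v \<in> W \<and> W \<subseteq> ?D \<and>
        (\<forall>k::3. multihomogeneous (idx n) e (P k)) \<and>
        (\<forall>u\<in>W. \<forall>x\<in>hom_coords (idx n) u. (\<chi> k. P k x) \<noteq> 0 \<and> ?f u j = proj (\<chi> k. P k x))"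
    using op v multihomogeneous_meet_vec[OF n dist]
    by (intro exI[of _ ?D] exI[of _ "\<lambda>i. if i \<in> {(j + a) mod int n, (j + b) mod int n, (j + c) mod int n, (j + d) mod int n} then 1 else 0"] exI[of _ ?P]) blast
qed

lemma rational_skew_pentagram_map:
  assumes n: "n > 0" and dist: "distinct [a mod int n, b mod int n, c mod int n, d mod int n]"
    and "skew_pentagram_dom n a b c d \<noteq> {}"
  shows "rational_map (idx n) (idx n) (skew_pentagram_map n a b c d)"
  unfolding rational_map_def
proof
  show "zariski_dense (idx n) (fst (skew_pentagram_map n a b c d))"
    using nonempty_open_dense[OF _ openin_skew_pentagram_dom[OF n dist] assms(3)]
    by (simp add: skew_pentagram_map_def)
  show "regular_on (idx n) (idx n) (fst (skew_pentagram_map n a b c d)) (snd (skew_pentagram_map n a b c d))"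
    using regular_on_skew_pentagram_map[OF n dist] by (simp add: skew_pentagram_map_def)
qed


section \<open>A family of maps of unbounded degree\<close>

locale six_fold =
  fixes g :: nat
  assumes g_pos: "g > 0"
begin

abbreviation n :: nat where "n \<equiv> 6 * g"
abbreviation G :: int where "G \<equiv> int g"
abbreviation T :: "(int, int) rat_rep" where "T \<equiv> skew_pentagram_map n 0 (3 * G) (2 * G) (4 * G)"
abbreviation Tdom :: "(int \<Rightarrow> cp2) set" where "Tdom \<equiv> skew_pentagram_dom n 0 (3 * G) (2 * G) (4 * G)"
abbreviation V :: "(int \<Rightarrow> cp2) \<Rightarrow> int \<Rightarrow> cp2" where "V \<equiv> vertex n"

lemma n_pos: "n > 0" using g_pos by simp

lemma V_periodic: "V v (j + 6 * G) = V v j"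
  by (simp add: vertex_def)

lemma V_shift:
  "V v (j + 3 * G + 3 * G) = V v j" "V v (j + 2 * G + 4 * G) = V v j" "V v (j + 4 * G + 2 * G) = V v j"
  "V v (j + 4 * G + 3 * G) = V v (j + G)" "V v (j + 4 * G + 4 * G) = V v (j + 2 * G)"
  "V v (j + 2 * G + 2 * G) = V v (j + 4 * G)" "V v (j + 2 * G + 3 * G) = V v (j + 5 * G)"
  using V_periodic[of v j] V_periodic[of v "j + G"] V_periodic[of v "j + 2 * G"]
  by (simp_all add: algebra_simps)

lemma shifts_distinct:
  "distinct [(i + 0) mod int n, (i + 2 * G) mod int n, (i + 4 * G) mod int n,
     (i + 3 * G) mod int n, (i + 5 * G) mod int n, (i + G) mod int n]"
proof -
  have ne: "(i + k * G) mod int n \<noteq> (i + l * G) mod int n" if "k \<in> {0..5}" "l \<in> {0..5}" "k \<noteq> l" for k l :: int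
  proof
    assume "(i + k * G) mod int n = (i + l * G) mod int n"
    hence "6 * G dvd k * G - l * G" by (simp add: mod_eq_dvd_iff)
    hence "6 dvd k - l" using g_pos by (simp flip: left_diff_distrib)
    moreover have "0 \<le> k" "k \<le> 5" "0 \<le> l" "l \<le> 5" using that by simp_all
    ultimately show False using that(3) by presburger
  qed
  show ?thesis
    using ne[of 0 1] ne[of 0 2] ne[of 0 3] ne[of 0 4] ne[of 0 5] ne[of 1 2] ne[of 1 3] ne[of 1 4]
      ne[of 1 5] ne[of 2 3] ne[of 2 4] ne[of 2 5] ne[of 3 4] ne[of 3 5] ne[of 4 5]
    by auto
qed

lemma offsets_distinct: "distinct [0 mod int n, 3 * G mod int n, 2 * G mod int n, 4 * G mod int n]"
  using shifts_distinct[of 0] by auto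

text \<open>The polynomial relations that will turn out to cut out the fiber over a generic \<open>y\<close>.\<close>

definition incidence :: "(int \<Rightarrow> cp2) \<Rightarrow> (int \<Rightarrow> cp2) set" where
  "incidence y = {v \<in> cp2_pow (idx n).
     \<forall>j. collinear3 (V v j) (V y j) (V y (j + 3 * G)) \<and> collinear3 (V v (j + 2 * G)) (V v (j + 4 * G)) (V y j)}"

text \<open>The candidates for the vertices \<open>i\<close>, \<open>i + 2 g\<close> and \<open>i + 4 g\<close>. The \<open>q\<close>-points are the
  ones opposite to the \<open>p\<close>-points, with indices \<open>i + 3 g\<close>, \<open>i + 5 g\<close> and \<open>i + 7 g \<equiv> i + g\<close>.\<close>

definition triangles :: "(int \<Rightarrow> cp2) \<Rightarrow> int \<Rightarrow> (cp2 \<times> cp2 \<times> cp2) set" where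
  "triangles y i = inscribed (V y i) (V y (i + 2 * G)) (V y (i + 4 * G))
     (V y (i + 3 * G)) (V y (i + 5 * G)) (V y (i + G))"

lemma incidence_triangles:
  assumes "v \<in> incidence y"
  shows "(V v i, V v (i + 2 * G), V v (i + 4 * G)) \<in> triangles y i"
proof -
  have 1: "collinear3 (V v j) (V y j) (V y (j + 3 * G))" for j using assms by (simp add: incidence_def)
  have 2: "collinear3 (V v (j + 2 * G)) (V v (j + 4 * G)) (V y j)" for j using assms by (simp add: incidence_def)
  show ?thesis
    using 1[of i] 1[of "i + 2 * G"] 1[of "i + 4 * G"] 2[of i] 2[of "i + 2 * G"] 2[of "i + 4 * G"]
    unfolding triangles_def inscribed_def V_shift by blast
qed

text \<open>The relations decouple: the triangles for different \<open>i < 2 g\<close> involve disjoint sets of vertices of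
  \<open>v\<close> and together use each vertex once.\<close>

lemma incidence_iff_triangles:
  "v \<in> incidence y \<longleftrightarrow> v \<in> cp2_pow (idx n) \<and>
     (\<forall>i\<in>{0..<2 * G}. (v i, v (i + 2 * G), v (i + 4 * G)) \<in> triangles y i)"
proof (intro iffI conjI ballI)
  assume v: "v \<in> incidence y"
  thus "v \<in> cp2_pow (idx n)" by (simp add: incidence_def)
  fix i assume i: "i \<in> {0..<2 * G}"
  hence "V v i = v i" "V v (i + 2 * G) = v (i + 2 * G)" "V v (i + 4 * G) = v (i + 4 * G)"
    by (simp_all add: vertex_def)
  thus "(v i, v (i + 2 * G), v (i + 4 * G)) \<in> triangles y i"
    using incidence_triangles[OF v, of i] by simp
next
  assume v: "v \<in> cp2_pow (idx n) \<and> (\<forall>i\<in>{0..<2 * G}. (v i, v (i + 2 * G), v (i + 4 * G)) \<in> triangles y i)"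
  let ?R = "\<lambda>j. collinear3 (V v j) (V y j) (V y (j + 3 * G)) \<and> collinear3 (V v (j + 2 * G)) (V v (j + 4 * G)) (V y j)"
  have R: "?R i \<and> ?R (i + 2 * G) \<and> ?R (i + 4 * G)" if i: "i \<in> {0..<2 * G}" for i
  proof -
    have "V v i = v i" "V v (i + 2 * G) = v (i + 2 * G)" "V v (i + 4 * G) = v (i + 4 * G)"
      using i by (simp_all add: vertex_def)
    hence "(V v i, V v (i + 2 * G), V v (i + 4 * G)) \<in> triangles y i" using v i by simp
    thus ?thesis unfolding triangles_def inscribed_def V_shift by blast
  qed
  have "?R j" for j
  proof -
    define r where "r = j mod (6 * G)"
    have r: "0 \<le> r" "r < 6 * G" using g_pos by (simp_all add: r_def)
    have "r \<in> {0..<2 * G} \<or> r - 2 * G \<in> {0..<2 * G} \<or> r - 4 * G \<in> {0..<2 * G}" using r by auto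
    hence "?R r" using R[of r] R[of "r - 2 * G"] R[of "r - 4 * G"] by fastforce
    moreover have "V u (r + k) = V u (j + k)" for u k by (simp add: r_def vertex_def mod_simps)
    from this[of _ 0] this have "?R r = ?R j" by simp
    ultimately show ?thesis by simp
  qed
  thus "v \<in> incidence y" using v by (simp add: incidence_def)
qed

lemma card_incidence:
  assumes "\<And>i. finite (triangles y i) \<and> card (triangles y i) = 2"
  shows "finite (incidence y) \<and> card (incidence y) = 2 ^ (2 * g)"
proof -
  let ?R = "{0..<2 * G}"
  let ?h = "\<lambda>v. \<lambda>i\<in>?R. (v i, v (i + 2 * G), v (i + 4 * G)) :: cp2 \<times> cp2 \<times> cp2"
  let ?k = "\<lambda>t. \<lambda>j\<in>idx n. if j < 2 * G then fst (t j) else if j < 4 * G then fst (snd (t (j - 2 * G)))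
     else snd (snd (t (j - 4 * G)))"
  have bij: "bij_betw ?h (incidence y) (PiE ?R (triangles y))"
  proof (rule bij_betw_byWitness[where f' = ?k])
    show "\<forall>v\<in>incidence y. ?k (?h v) = v"
    proof (intro ballI ext)
      fix v j assume v: "v \<in> incidence y"
      hence "v \<in> extensional (idx n)" by (simp add: incidence_iff_triangles PiE_def)
      thus "?k (?h v) j = v j" by (cases "j \<in> idx n") (auto simp: extensional_def)
    qed
    show "\<forall>t\<in>PiE ?R (triangles y). ?h (?k t) = t"
    proof (intro ballI ext)
      fix t i assume t: "t \<in> PiE ?R (triangles y)"
      show "?h (?k t) i = t i"
        using t by (cases "i \<in> ?R") (auto simp: PiE_def extensional_def)
    qed
    show "?h ` incidence y \<subseteq> PiE ?R (triangles y)"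
      by (auto simp: incidence_iff_triangles)
    show "?k ` PiE ?R (triangles y) \<subseteq> incidence y"
    proof
      fix v assume "v \<in> ?k ` PiE ?R (triangles y)"
      then obtain t where t: "t \<in> PiE ?R (triangles y)" "v = ?k t" by blast
      have "(v i, v (i + 2 * G), v (i + 4 * G)) = t i" if "i \<in> ?R" for i
        using that by (simp add: t(2))
      moreover have "v \<in> cp2_pow (idx n)" unfolding t(2) by auto
      ultimately show "v \<in> incidence y" using t(1) by (auto simp: incidence_iff_triangles)
    qed
  qed
  have "finite (PiE ?R (triangles y))" by (rule finite_PiE) (use assms in auto)
  moreover have "card (PiE ?R (triangles y)) = 2 ^ (2 * g)"
    using assms by (simp add: card_PiE nat_mult_distrib)
  ultimately show ?thesis
    unfolding bij_betw_finite[OF bij] bij_betw_same_card[OF bij] by (rule conjI)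
qed

definition genericity_at :: "int \<Rightarrow> (int \<Rightarrow> complex^3) \<Rightarrow> complex" where
  "genericity_at i x = genericity (x ((i + 0) mod int n)) (x ((i + 2 * G) mod int n)) (x ((i + 4 * G) mod int n))
     (x ((i + 3 * G) mod int n)) (x ((i + 5 * G) mod int n)) (x ((i + G) mod int n))"

definition genericity_poly :: "(int \<Rightarrow> complex^3) \<Rightarrow> complex" where
  "genericity_poly x = (\<Prod>i\<in>idx n. genericity_at i x)"

definition generic :: "(int \<Rightarrow> cp2) set" where
  "generic = nonvanishing_locus (idx n) genericity_poly"

lemma multihomogeneous_genericity_poly: "\<exists>e. multihomogeneous (idx n) e genericity_poly"
proof -
  have "\<exists>e. multihomogeneous (idx n) e (genericity_at i)" for i
  proof -
    have "j mod int n \<in> idx n" for j using n_pos by simp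
    hence s: "{(i + 0) mod int n, (i + 2 * G) mod int n, (i + 4 * G) mod int n,
      (i + 3 * G) mod int n, (i + 5 * G) mod int n, (i + G) mod int n} \<subseteq> idx n" by blast
    show ?thesis
      using multihomogeneous_genericity[OF s shifts_distinct] unfolding genericity_at_def by blast
  qed
  then obtain e where e: "\<And>i. multihomogeneous (idx n) (e i) (genericity_at i)" by metis
  have "multihomogeneous (idx n) (\<lambda>j. \<Sum>i\<in>idx n. e i j) (\<lambda>x. \<Prod>i\<in>idx n. genericity_at i x)"
    by (intro multihomogeneous_prod e) simp
  thus ?thesis unfolding genericity_poly_def by blast
qed

lemma openin_generic: "openin (zariski (idx n)) generic"
  unfolding generic_def using multihomogeneous_genericity_poly openin_nonvanishing_locus by blast

text \<open>The example for six points is placed at the indices \<open>i + k g\<close> for \<open>k < 6\<close>, which are distinct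
  modulo \<open>n\<close>.\<close>

lemma genericity_at_nonzero: "\<exists>x. genericity_at i x \<noteq> 0"
proof -
  define W :: "int \<Rightarrow> complex^3" where
    "W k = (if k = 0 then vector [1, 0, 0] else if k = 2 then vector [0, 1, 0]
       else if k = 4 then vector [0, 0, 1] else if k = 3 then vector [1, 1, 1]
       else if k = 5 then vector [-1, 0, 1] else vector [1, 1, 0])" for k
  define x where "x j = W (((j - i) mod int n) div G)" for j
  have x: "x ((i + k * G) mod int n) = W k" if "k \<in> {0..5}" for k
  proof -
    have "((i + k * G) mod int n - i) mod int n = k * G mod int n" by (simp add: mod_simps)
    also have "\<dots> = k * G" using that g_pos by (intro mod_pos_pos_trivial) auto
    finally show ?thesis using g_pos by (simp add: x_def)
  qed
  have "genericity_at i x \<noteq> 0"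
    using x[of 0] x[of 1] x[of 2] x[of 3] x[of 4] x[of 5] genericity_example
    by (simp add: genericity_at_def W_def)
  thus ?thesis by blast
qed

lemma generic_nonempty: "generic \<noteq> {}"
proof -
  obtain e where e: "multihomogeneous (idx n) e genericity_poly" using multihomogeneous_genericity_poly by blast
  have p: "polynomial_fun (idx n) (genericity_at i)" for i
  proof -
    have "j mod int n \<in> idx n" for j using n_pos by simp
    thus ?thesis unfolding genericity_at_def by (intro polynomial_fun_genericity) blast
  qed
  have "\<exists>x. genericity_poly x \<noteq> 0"
    unfolding genericity_poly_def by (intro polynomial_fun_prod_nonzero[of _ "idx n"] p genericity_at_nonzero) simp
  then obtain x where "genericity_poly x \<noteq> 0" ..
  then obtain z where z: "genericity_poly z \<noteq> 0" "\<And>i. i \<in> idx n \<Longrightarrow> z i \<noteq> 0"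
    using polynomial_fun_nonzero_at_hom_coords[of "idx n" genericity_poly x] e
    by (auto simp: multihomogeneous_def)
  have "(\<lambda>i\<in>idx n. proj (z i)) \<in> generic"
    unfolding generic_def
    using in_nonvanishing_locus_iff[OF _ e hom_coords_proj[OF z(2)]] z(1) by auto
  thus ?thesis by blast
qed

context
  fixes y x
  assumes y: "y \<in> generic" and x: "x \<in> hom_coords (idx n) y"
begin

lemma generic_hexagon:
  "genericity (x (i mod int n)) (x ((i + 2 * G) mod int n)) (x ((i + 4 * G) mod int n))
     (x ((i + 3 * G) mod int n)) (x ((i + 5 * G) mod int n)) (x ((i + G) mod int n)) \<noteq> 0"
proof -
  have "genericity_poly x \<noteq> 0" using y x by (auto simp: generic_def nonvanishing_locus_def)
  hence "\<forall>i\<in>idx n. genericity_at i x \<noteq> 0" by (simp add: genericity_poly_def)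
  moreover have "i mod int n \<in> idx n" using n_pos by simp
  ultimately have "genericity_at (i mod int n) x \<noteq> 0" by blast
  thus ?thesis by (simp add: genericity_at_def mod_simps)
qed

lemma triangles_eq:
  "triangles y i = inscribed (proj (x (i mod int n))) (proj (x ((i + 2 * G) mod int n)))
     (proj (x ((i + 4 * G) mod int n))) (proj (x ((i + 3 * G) mod int n)))
     (proj (x ((i + 5 * G) mod int n))) (proj (x ((i + G) mod int n)))"
  unfolding triangles_def vertex_hom_coords(2)[OF n_pos x] ..

lemma card_triangles: "finite (triangles y i) \<and> card (triangles y i) = 2"
  unfolding triangles_eq
  using six_points.card_inscribed[OF six_points_if_generic[OF generic_hexagon]] by blast

lemma incidence_not_collinear3:
  assumes "v \<in> incidence y"
  shows "\<not> collinear3 (V v i) (V v (i + 2 * G)) (V v (i + 4 * G))"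
proof -
  interpret six_points "x (i mod int n)" "x ((i + 2 * G) mod int n)" "x ((i + 4 * G) mod int n)"
     "x ((i + 3 * G) mod int n)" "x ((i + 5 * G) mod int n)" "x ((i + G) mod int n)"
    by (rule six_points_if_generic[OF generic_hexagon])
  have "al2 * be3 * ga1 \<noteq> al3 * be1 * ga2"
    using generic_hexagon[of i]
    unfolding genericity_def al2_def al3_def be1_def be3_def ga1_def ga2_def by auto
  thus ?thesis
    using inscribed_not_collinear3[OF incidence_triangles[OF assms, of i, unfolded triangles_eq]] by blast
qed

text \<open>Passing from \<open>i\<close> to \<open>i + 3 g\<close> interchanges the \<open>p\<close>-points and the \<open>q\<close>-points.\<close>

lemma incidence_opposite_distinct:
  assumes "v \<in> incidence y"
  shows "V v i \<noteq> V v (i + 3 * G)"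
proof -
  have e: "x ((j + 6 * G) mod int n) = x (j mod int n)" for j by simp
  have sh: "x ((i + 3 * G + 2 * G) mod int n) = x ((i + 5 * G) mod int n)"
    "x ((i + 3 * G + 4 * G) mod int n) = x ((i + G) mod int n)"
    "x ((i + 3 * G + 3 * G) mod int n) = x (i mod int n)"
    "x ((i + 3 * G + 5 * G) mod int n) = x ((i + 2 * G) mod int n)"
    "x ((i + 3 * G + G) mod int n) = x ((i + 4 * G) mod int n)"
    using e[of i] e[of "i + G"] e[of "i + 2 * G"] by (simp_all add: algebra_simps)
  show ?thesis
    by (rule inscribed_disjoint[OF generic_hexagon[of i] generic_hexagon[of "i + 3 * G", unfolded sh]
        incidence_triangles[OF assms, of i, unfolded triangles_eq]
        incidence_triangles[OF assms, of "i + 3 * G", unfolded triangles_eq sh]])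
qed

lemma generic_opposite_distinct: "V y i \<noteq> V y (i + 3 * G)"
proof -
  let ?p = "x (i mod int n)" and ?q = "x ((i + 3 * G) mod int n)" and ?r = "x ((i + 4 * G) mod int n)"
  have d: "det3 ?p ?q ?r \<noteq> 0" using generic_hexagon[of i] by (simp add: genericity_def)
  have "?p \<noteq> 0" "?q \<noteq> 0" "?r \<noteq> 0" by (rule vertex_hom_coords(1)[OF n_pos x])+
  with d have "\<not> collinear3 (V y i) (V y (i + 3 * G)) (V y (i + 4 * G))"
    by (simp add: vertex_hom_coords(2)[OF n_pos x, symmetric] collinear3_proj_iff)
  thus ?thesis using collinear3_refl collinear3_swap by metis
qed

text \<open>For generic \<open>y\<close> every solution of the relations is an honest preimage: the vertices
  that span a line are distinct, the two lines of each index differ, and both contain \<open>y\<^sub>i\<close>.\<close>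

lemma incidence_image:
  assumes v: "v \<in> incidence y"
  shows "v \<in> Tdom \<and> snd T v = y"
proof -
  have V: "v \<in> cp2_pow (idx n)" using v by (simp add: incidence_def)
  have 1: "collinear3 (V v j) (V y j) (V y (j + 3 * G))" for j using v by (simp add: incidence_def)
  have 2: "collinear3 (V v (j + 2 * G)) (V v (j + 4 * G)) (V y j)" for j using v by (simp add: incidence_def)
  have d1: "V v i \<noteq> V v (i + 3 * G)" for i using incidence_opposite_distinct[OF v] .
  have d2: "V v (i + 2 * G) \<noteq> V v (i + 4 * G)" for i
    using incidence_not_collinear3[OF v, of i] collinear3_refl by metis
  have "proj_line (V v i) (V v (i + 3 * G)) \<noteq> proj_line (V v (i + 2 * G)) (V v (i + 4 * G))" for i
  proof
    assume "proj_line (V v i) (V v (i + 3 * G)) = proj_line (V v (i + 2 * G)) (V v (i + 4 * G))"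
    moreover have "V v i \<in> proj_line (V v i) (V v (i + 3 * G))"
      using in_proj_line_iff_collinear3[OF d1] collinear3_refl by blast
    ultimately have "collinear3 (V v (i + 2 * G)) (V v (i + 4 * G)) (V v i)"
      using in_proj_line_iff_collinear3[OF d2] by blast
    thus False using incidence_not_collinear3[OF v, of i] collinear3_swap by blast
  qed
  hence dom: "v \<in> Tdom" using V d1 d2 by (simp add: skew_pentagram_dom_def)
  have y1: "collinear3 (V v i) (V v (i + 3 * G)) (V y i)" for i
  proof (rule collinear3_trans[OF generic_opposite_distinct[of i]])
    show "collinear3 (V y i) (V y (i + 3 * G)) (V v i)" using 1[of i] collinear3_swap by blast
    show "collinear3 (V y i) (V y (i + 3 * G)) (V v (i + 3 * G))"
      using 1[of "i + 3 * G"] collinear3_swap unfolding V_shift by blast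
  qed (rule collinear3_refl)
  have "snd T v i = y i" if i: "i \<in> idx n" for i
  proof -
    have e: "V y i = y i" using i by (simp add: vertex_def)
    obtain z where "z \<in> hom_coords (idx n) v" using hom_coords_nonempty by blast
    note meet = skew_pentagram_lines_meet[OF n_pos dom this i]
    have "y i \<in> proj_line (V v (i + 0)) (V v (i + 3 * G)) \<inter> proj_line (V v (i + 2 * G)) (V v (i + 4 * G))"
      using y1[of i] 2[of i] in_proj_line_iff_collinear3[OF d1] in_proj_line_iff_collinear3[OF d2] e by simp
    thus ?thesis unfolding meet by simp
  qed
  moreover have "snd T v \<in> extensional (idx n)" by (simp add: skew_pentagram_map_def)
  moreover have "y \<in> extensional (idx n)"
    using y by (auto simp: generic_def nonvanishing_locus_def PiE_def)
  ultimately show ?thesis using dom extensionalityI by blast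
qed

end

lemma Tdom_nonempty: "Tdom \<noteq> {}"
proof -
  obtain y where y: "y \<in> generic" using generic_nonempty by blast
  obtain x where x: "x \<in> hom_coords (idx n) y" using hom_coords_nonempty by blast
  have "card (incidence y) \<noteq> 0" using card_incidence[OF card_triangles[OF y x]] by simp
  then obtain v where "v \<in> incidence y" by fastforce
  thus ?thesis using incidence_image[OF y x] by blast
qed

lemma rational_T: "rational_map (idx n) (idx n) T"
  by (rule rational_skew_pentagram_map[OF n_pos offsets_distinct Tdom_nonempty])

text \<open>Both relations are polynomial, so it suffices to verify them on the geometric domain. There
  \<open>v\<^sub>i \<noteq> v\<^sub>i\<^sub>+\<^sub>3\<^sub>g\<close>, and \<open>y\<^sub>i\<close> and \<open>y\<^sub>i\<^sub>+\<^sub>3\<^sub>g\<close> both lie on the line joining these vertices.\<close>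

lemma rat_graph_incidence:
  assumes vy: "(v, y) \<in> rat_graph (idx n) (idx n) T"
  shows "v \<in> incidence y"
proof -
  have m: "j mod int n \<in> idx n" for j using n_pos by simp
  obtain x where x: "x \<in> hom_coords (idx n) v" using hom_coords_nonempty by blast
  note closed = rat_graph_closed_relation[OF _ _ rational_T vy _ _ x]
  have p: "polynomial_fun (idx n) (\<lambda>x. (\<chi> k. P j k x) $ k)"
    if "\<And>j k. polynomial_fun (idx n) (P j k)" for P :: "int \<Rightarrow> 3 \<Rightarrow> (int \<Rightarrow> complex^3) \<Rightarrow> complex" and j k
    using that by simp
  have c: "polynomial_fun (idx n) (\<lambda>x. x (j mod int n) $ k)" for j k
    by (intro polynomial_fun.coord m)
  have D: "u \<in> Tdom" if "u \<in> fst T" for u using that by (simp add: skew_pentagram_map_def)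
  have "collinear3 (V v j) (V y j) (V y (j + 3 * G))" for j
  proof -
    have "\<exists>w\<in>hom_coords (idx n) y. det3 (x (j mod int n)) (w (j mod int n)) (w ((j + 3 * G) mod int n)) = 0"
    proof (rule closed)
      fix u x w assume u: "u \<in> fst T" and x: "x \<in> hom_coords (idx n) u"
        and w: "w \<in> hom_coords (idx n) (snd T u)"
      let ?y = "snd T u"
      note im = skew_pentagram_image[OF n_pos D[OF u]]
      have "collinear3 (V u j) (V ?y j) (V ?y (j + 3 * G))"
      proof (rule collinear3_trans)
        show "V u j \<noteq> V u (j + 3 * G)" using im(1)[of j] by simp
        show "collinear3 (V u j) (V u (j + 3 * G)) (V u j)" by (rule collinear3_refl)
        show "collinear3 (V u j) (V u (j + 3 * G)) (V ?y j)" using im(3)[of j] by simp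
        show "collinear3 (V u j) (V u (j + 3 * G)) (V ?y (j + 3 * G))"
          using im(3)[of "j + 3 * G"] collinear3_swap unfolding V_shift add_0_right by blast
      qed
      thus "det3 (x (j mod int n)) (w (j mod int n)) (w ((j + 3 * G) mod int n)) = 0"
        unfolding vertex_hom_coords(2)[OF n_pos x, symmetric] vertex_hom_coords(2)[OF n_pos w, symmetric]
        by (subst (asm) collinear3_proj_iff) (intro vertex_hom_coords(1)[OF n_pos x] vertex_hom_coords(1)[OF n_pos w])+
    next
      fix P :: "int \<Rightarrow> 3 \<Rightarrow> (int \<Rightarrow> complex^3) \<Rightarrow> complex"
      assume "\<And>j k. polynomial_fun (idx n) (P j k)"
      note p = p[OF this]
      show "polynomial_fun (idx n) (\<lambda>x. det3 (x (j mod int n)) (\<chi> k. P (j mod int n) k x)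
          (\<chi> k. P ((j + 3 * G) mod int n) k x))"
        by (intro polynomial_fun_det3 p c)
    qed simp_all
    then obtain w where w: "w \<in> hom_coords (idx n) y"
      "det3 (x (j mod int n)) (w (j mod int n)) (w ((j + 3 * G) mod int n)) = 0" by blast
    thus ?thesis
      unfolding vertex_hom_coords(2)[OF n_pos x, symmetric] vertex_hom_coords(2)[OF n_pos w(1), symmetric]
      using w(2) by (simp only: collinear3_proj_iff[OF vertex_hom_coords(1)[OF n_pos x]
          vertex_hom_coords(1)[OF n_pos w(1)] vertex_hom_coords(1)[OF n_pos w(1)]])
  qed
  moreover have "collinear3 (V v (j + 2 * G)) (V v (j + 4 * G)) (V y j)" for j
  proof -
    have "\<exists>w\<in>hom_coords (idx n) y.
      det3 (x ((j + 2 * G) mod int n)) (x ((j + 4 * G) mod int n)) (w (j mod int n)) = 0"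
    proof (rule closed)
      fix u x w assume u: "u \<in> fst T" and x: "x \<in> hom_coords (idx n) u"
        and w: "w \<in> hom_coords (idx n) (snd T u)"
      from skew_pentagram_image(4)[OF n_pos D[OF u], of j]
      show "det3 (x ((j + 2 * G) mod int n)) (x ((j + 4 * G) mod int n)) (w (j mod int n)) = 0"
        unfolding vertex_hom_coords(2)[OF n_pos x, symmetric] vertex_hom_coords(2)[OF n_pos w, symmetric]
        by (subst (asm) collinear3_proj_iff) (intro vertex_hom_coords(1)[OF n_pos x] vertex_hom_coords(1)[OF n_pos w])+
    next
      fix P :: "int \<Rightarrow> 3 \<Rightarrow> (int \<Rightarrow> complex^3) \<Rightarrow> complex"
      assume "\<And>j k. polynomial_fun (idx n) (P j k)"
      note p = p[OF this]
      show "polynomial_fun (idx n) (\<lambda>x. det3 (x ((j + 2 * G) mod int n)) (x ((j + 4 * G) mod int n))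
          (\<chi> k. P (j mod int n) k x))"
        by (intro polynomial_fun_det3 p c)
    qed simp_all
    then obtain w where w: "w \<in> hom_coords (idx n) y"
      "det3 (x ((j + 2 * G) mod int n)) (x ((j + 4 * G) mod int n)) (w (j mod int n)) = 0" by blast
    thus ?thesis
      unfolding vertex_hom_coords(2)[OF n_pos x, symmetric] vertex_hom_coords(2)[OF n_pos w(1), symmetric]
      using w(2) by (simp only: collinear3_proj_iff[OF vertex_hom_coords(1)[OF n_pos x]
          vertex_hom_coords(1)[OF n_pos x] vertex_hom_coords(1)[OF n_pos w(1)]])
  qed
  moreover have "v \<in> cp2_pow (idx n)"
  proof -
    obtain s where s: "rational_map (idx n) (idx n) s" "v \<in> fst s"
      using vy unfolding rat_graph_def by blast
    have "openin (zariski (idx n)) (fst s)" using s(1) unfolding rational_map_def regular_on_def by blast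
    from openin_subset[OF this] s(2) show ?thesis unfolding topspace_zariski by blast
  qed
  ultimately show ?thesis by (simp add: incidence_def)
qed

lemma rat_fiber_generic:
  assumes y: "y \<in> generic"
  shows "rat_fiber (idx n) (idx n) T y = incidence y"
proof (intro subset_antisym subsetI)
  fix v assume "v \<in> rat_fiber (idx n) (idx n) T y"
  thus "v \<in> incidence y" using rat_graph_incidence by (simp add: rat_fiber_def)
next
  fix v assume v: "v \<in> incidence y"
  obtain x where x: "x \<in> hom_coords (idx n) y" using hom_coords_nonempty by blast
  have "v \<in> fst T" "snd T v = y"
    using incidence_image[OF y x v] by (simp_all add: skew_pentagram_map_def)
  moreover have "same_rational_map T T" by (simp add: same_rational_map_def)
  ultimately show "v \<in> rat_fiber (idx n) (idx n) T y"
    using rational_T unfolding rat_fiber_def rat_graph_def by blast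
qed

lemma generic_fiber:
  assumes "y \<in> generic"
  shows "finite (rat_fiber (idx n) (idx n) T y) \<and> card (rat_fiber (idx n) (idx n) T y) = 2 ^ (2 * g)"
proof -
  obtain x where x: "x \<in> hom_coords (idx n) y" using hom_coords_nonempty by blast
  show ?thesis
    unfolding rat_fiber_generic[OF assms] by (rule card_incidence[OF card_triangles[OF assms x]])
qed

lemma zariski_dense_generic: "zariski_dense (idx n) generic"
  by (rule nonempty_open_dense[OF _ openin_generic generic_nonempty]) simp

lemma top_degree_T: "has_top_degree (idx n) (idx n) T (2 ^ (2 * g))"
  unfolding has_top_degree_def using openin_generic zariski_dense_generic generic_fiber by blast

lemma dominant_T: "dominant (idx n) (idx n) T"
  unfolding dominant_def
proof
  have "y \<in> Range (rat_graph (idx n) (idx n) T)" if "y \<in> generic" for y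
  proof -
    have "card (rat_fiber (idx n) (idx n) T y) \<noteq> 0" using generic_fiber[OF that] by simp
    hence "rat_fiber (idx n) (idx n) T y \<noteq> {}" by auto
    thus ?thesis by (auto simp: rat_fiber_def)
  qed
  thus "zariski_dense (idx n) (Range (rat_graph (idx n) (idx n) T))"
    by (intro zariski_dense_mono[OF zariski_dense_generic]) blast
qed (rule rational_T)

end

theorem corollary7p9:
  "\<forall>B::nat. \<exists>(n::nat) (a::int) (b::int) (c::int) (d::int).
     n \<ge> 4 \<and>
     distinct [a mod int n, b mod int n, c mod int n, d mod int n] \<and>
     \<bar>b - a\<bar> \<noteq> \<bar>d - c\<bar> \<and>
     dominant (idx n) (idx n) (skew_pentagram_map n a b c d) \<and>
     (\<exists>k. has_top_degree (idx n) (idx n) (skew_pentagram_map n a b c d) k \<and> k > B)"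
proof
  fix B :: nat
  define g where "g = Suc B"
  interpret six_fold g by unfold_locales (simp add: g_def)
  have "B < 2 * g" by (simp add: g_def)
  also have "2 * g < 2 ^ (2 * g)" by (rule less_exp)
  finally have "B < 2 ^ (2 * g)" .
  moreover have "n \<ge> 4" "\<bar>3 * G - 0\<bar> \<noteq> \<bar>4 * G - 2 * G\<bar>" using g_pos by simp_all
  ultimately show "\<exists>(n::nat) (a::int) (b::int) (c::int) (d::int).
     n \<ge> 4 \<and>
     distinct [a mod int n, b mod int n, c mod int n, d mod int n] \<and>
     \<bar>b - a\<bar> \<noteq> \<bar>d - c\<bar> \<and>
     dominant (idx n) (idx n) (skew_pentagram_map n a b c d) \<and>
     (\<exists>k. has_top_degree (idx n) (idx n) (skew_pentagram_map n a b c d) k \<and> k > B)"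
    using offsets_distinct dominant_T top_degree_T by blast
qed

end
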